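(* The antisymmetric Green's functions on the double covers of the square lattice branched over a face ($\Xi$) and over a vertex ($\Sigma$) are given as follows. For $v,w\in\Xi$, $$G^A_\Xi(v,w)=\epsilon(v,w)\,G_Z\big(v^\pi-(\tfrac12,\tfrac12),\,w^\pi-(\tfrac12,\tfrac12)\big),$$ and for $v,w\in\Sigma$, $$G^A_\Sigma(v,w)=\epsilon(v,w)\left[G_Z(v^\pi,w^\pi)-\frac{G_Z(v^\pi,0)\,G_Z(0,w^\pi)}{G_Z(0,0)}\right],$$ where $\epsilon(v,w)=+1$ if $v$ and $w$ are on the same branch and $\epsilon(v,w)=-1$ if they are on opposite branches.
   Context: All Laplacians are $\Delta f(v)=\sum_{v'\sim v}(f(v)-f(v'))$ with unit conductances. Double covers: $\Sigma$ is the double cover of the graph $\mathbb{Z}^2$ branched over the origin (two vertices over each vertex of $\mathbb{Z}^2$ other than $0$, and one vertex, of degree $8$, over $0$). $\Xi$ is the double cover of the graph $(\mathbb{Z}+\tfrac12)^2$ branched over the face centred at the origin. $\pi$ denotes the projection $\Sigma\to\mathbb{Z}^2$ or $\Xi\to(\mathbb{Z}+\frac12)^2$, written $v\mapsto v^\pi$, and $\sigma:v\mapsto v^\sigma$ is the map exchanging the two sheets. For $z\in\mathbb{Z}^2$ or $z\in(\mathbb{Z}+\frac12)^2$, $z^\beta$ is the lift of $z$ to the principal branch, defined by a branch cut along but just below the negative diagonal: for adjacent $z_1,z_2$ the lifts $z_1^\beta,z_2^\beta$ are adjacent, except for pairs $\{(-k,-k),(-k+1,-k)\}$ and $\{(-k,-k),(-k,-k-1)\}$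 with $2k\ge1$. The other branch consists of the points $z^{\beta\sigma}$. (If $v$ or $w$ is the branch vertex of $\Sigma$, both sides of the formula are $0$ and $\epsilon$ is irrelevant.) Green's functions: $G_\Sigma(v,w)=\lim_{n\to\infty}[G_n(v,w)-G_n(v,v)]$ where $G_n$ is the Green's function (inverse Laplacian) on the double branched cover of the box $\mathbb{Z}^2\cap[-n,n]^2$ with Dirichlet boundary conditions; $G_\Xi$ is defined in the same way. Then $G^A_\Sigma(v,w)=G_\Sigma(v,w)-G_\Sigma(v^\sigma,w)$ and $G^A_\Xi(v,w)=G_\Xi(v,w)-G_\Xi(v^\sigma,w)$. Zipper Green's function: let $Z$ be the set of edges $\{(-k,-k),(-k+1,-k)\}$ and $\{(-k,-k),(-k,-k-1)\}$, $k\ge1$ integer, of $\mathbb{Z}^2$ (edges crossed by a dual path from the face centred at $(-\tfrac12,-\tfrac12)$ to $\infty$ just below the negative diagonal). $\Delta_Zf(v)=\sum_{v'\sim v}(f(v)-c_{vv'}f(v'))$ with $c_{vv'}=-1$ for edges in $Z$ and $+1$ otherwise, and $G_Z$ is its inverse on $\mathbb{Z}^2$ (limit as $n\to\infty$ of the inverses on $[-n,n]^2\cap\mathbb{Z}^2$ with Dirichlet boundary). *)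

theory Defs
  imports "HOL-Analysis.Analysis"
begin

section \<open>Lattices and the branch cut\<close>

type_synonym point = "real \<times> real"

definition Z2 :: "point set" where
  "Z2 = \<int> \<times> \<int>"

definition H2 :: "point set" where
  "H2 = {z. z - (1/2, 1/2) \<in> Z2}"

definition nn :: "point \<Rightarrow> point \<Rightarrow> bool" where
  "nn z w \<longleftrightarrow> \<bar>fst z - fst w\<bar> + \<bar>snd z - snd w\<bar> = 1"

definition sq_box :: "nat \<Rightarrow> point set" where
  "sq_box n = {- real n .. real n} \<times> {- real n .. real n}"

text \<open>Edges crossed by the cut just below the negative diagonal. For edges of \<open>Z2\<close> the
  parameter \<open>k\<close> is forced to be an integer, for edges of \<open>H2\<close> a half-integer.\<close>

definition branch_cut :: "point \<Rightarrow> point \<Rightarrow> bool" where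
  "branch_cut z w \<longleftrightarrow> (\<exists>k::real. 2 * k \<ge> 1 \<and>
     ({z, w} = {(-k, -k), (-k + 1, -k)} \<or> {z, w} = {(-k, -k), (-k, -k - 1)}))"


section \<open>Double covers\<close>

text \<open>A vertex of the double cover of \<open>L\<close> is a point of \<open>L\<close> together with a sheet; \<open>True\<close> is the
  principal branch. The branch vertex, present if \<open>0 \<in> L\<close>, has the single representative
  \<open>(0, True)\<close>.\<close>

type_synonym cpoint = "point \<times> bool"

definition cover :: "point set \<Rightarrow> cpoint set" where
  "cover L = {(z, s). z \<in> L \<and> (z = 0 \<longrightarrow> s)}"

definition cover_proj :: "cpoint \<Rightarrow> point" where
  "cover_proj v = fst v"

definition principal_lift :: "point \<Rightarrow> cpoint" where
  "principal_lift z = (z, True)"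

definition sheet_swap :: "cpoint \<Rightarrow> cpoint" where
  "sheet_swap v = (fst v, if fst v = 0 then snd v else \<not> snd v)"

definition cover_adj :: "cpoint \<Rightarrow> cpoint \<Rightarrow> bool" where
  "cover_adj v w \<longleftrightarrow> nn (cover_proj v) (cover_proj w) \<and>
     (cover_proj v = 0 \<or> cover_proj w = 0 \<or>
      (snd v = snd w \<longleftrightarrow> \<not> branch_cut (cover_proj v) (cover_proj w)))"

definition cover_nbrs :: "point set \<Rightarrow> cpoint \<Rightarrow> cpoint set" where
  "cover_nbrs L v = {v' \<in> cover L. cover_adj v v'}"

definition cover_box :: "point set \<Rightarrow> nat \<Rightarrow> cpoint set" where
  "cover_box L n = {v \<in> cover L. cover_proj v \<in> sq_box n}"

abbreviation Sigma_cover :: "cpoint set" where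
  "Sigma_cover \<equiv> cover Z2"

abbreviation Xi_cover :: "cpoint set" where
  "Xi_cover \<equiv> cover H2"

definition eps :: "cpoint \<Rightarrow> cpoint \<Rightarrow> real" where
  "eps v w = (if snd v = snd w then 1 else -1)"


section \<open>Green's functions\<close>

text \<open>The inverse of the operator \<open>\<Delta>\<close> on the finite set \<open>B\<close>, acting on functions which vanish
  outside \<open>B\<close> (Dirichlet boundary conditions).\<close>

definition dirichlet_green ::
    "(('a \<Rightarrow> real) \<Rightarrow> 'a \<Rightarrow> real) \<Rightarrow> 'a set \<Rightarrow> 'a \<Rightarrow> 'a \<Rightarrow> real" where
  "dirichlet_green \<Delta> B = (THE g.
     (\<forall>v w. v \<notin> B \<or> w \<notin> B \<longrightarrow> g v w = 0) \<and>
     (\<forall>v\<in>B. \<forall>w\<in>B. \<Delta> (\<lambda>u. g u w) v = (if v = w then 1 else 0)))"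

definition cover_laplacian :: "point set \<Rightarrow> (cpoint \<Rightarrow> real) \<Rightarrow> cpoint \<Rightarrow> real" where
  "cover_laplacian L f v = (\<Sum>v'\<in>cover_nbrs L v. f v - f v')"

definition cover_green_n :: "point set \<Rightarrow> nat \<Rightarrow> cpoint \<Rightarrow> cpoint \<Rightarrow> real" where
  "cover_green_n L n = dirichlet_green (cover_laplacian L) (cover_box L n)"

definition cover_green :: "point set \<Rightarrow> cpoint \<Rightarrow> cpoint \<Rightarrow> real" where
  "cover_green L v w = lim (\<lambda>n. cover_green_n L n v w - cover_green_n L n v v)"

definition cover_green_anti :: "point set \<Rightarrow> cpoint \<Rightarrow> cpoint \<Rightarrow> real" where
  "cover_green_anti L v w = cover_green L v w - cover_green L (sheet_swap v) w"

abbreviation GA_Sigma :: "cpoint \<Rightarrow> cpoint \<Rightarrow> real" where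
  "GA_Sigma \<equiv> cover_green_anti Z2"

abbreviation GA_Xi :: "cpoint \<Rightarrow> cpoint \<Rightarrow> real" where
  "GA_Xi \<equiv> cover_green_anti H2"

definition zipper :: "point set set" where
  "zipper = (\<Union>k\<in>{1::int..}.
     {{(- of_int k, - of_int k), (- of_int k + 1, - of_int k)},
      {(- of_int k, - of_int k), (- of_int k, - of_int k - 1)}})"

definition zipper_cond :: "point \<Rightarrow> point \<Rightarrow> real" where
  "zipper_cond v v' = (if {v, v'} \<in> zipper then -1 else 1)"

definition zipper_laplacian :: "(point \<Rightarrow> real) \<Rightarrow> point \<Rightarrow> real" where
  "zipper_laplacian f v = (\<Sum>v' | v' \<in> Z2 \<and> nn v v'. f v - zipper_cond v v' * f v')"

definition G_Z_n :: "nat \<Rightarrow> point \<Rightarrow> point \<Rightarrow> real" where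
  "G_Z_n n = dirichlet_green zipper_laplacian (Z2 \<inter> sq_box n)"

definition G_Z :: "point \<Rightarrow> point \<Rightarrow> real" where
  "G_Z v w = lim (\<lambda>n. G_Z_n n v w)"


section \<open>The covers have the intended structure\<close>

lemma branch_cut_iff:
  "branch_cut (a, b) (c, d) \<longleftrightarrow>
     a = b \<and> 2 * a \<le> -1 \<and> (c = a + 1 \<and> d = b \<or> c = a \<and> d = b - 1) \<or>
     c = d \<and> 2 * c \<le> -1 \<and> (a = c + 1 \<and> b = d \<or> a = c \<and> b = d - 1)"
proof
  assume "branch_cut (a, b) (c, d)"
  then show "a = b \<and> 2 * a \<le> -1 \<and> (c = a + 1 \<and> d = b \<or> c = a \<and> d = b - 1) \<or>
     c = d \<and> 2 * c \<le> -1 \<and> (a = c + 1 \<and> b = d \<or> a = c \<and> b = d - 1)"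
    unfolding branch_cut_def by (auto simp: doubleton_eq_iff)
next
  assume *: "a = b \<and> 2 * a \<le> -1 \<and> (c = a + 1 \<and> d = b \<or> c = a \<and> d = b - 1) \<or>
     c = d \<and> 2 * c \<le> -1 \<and> (a = c + 1 \<and> b = d \<or> a = c \<and> b = d - 1)"
  then show "branch_cut (a, b) (c, d)"
  proof
    assume "a = b \<and> 2 * a \<le> -1 \<and> (c = a + 1 \<and> d = b \<or> c = a \<and> d = b - 1)"
    then show ?thesis unfolding branch_cut_def
      by (intro exI[of _ "-a"]) (auto simp: doubleton_eq_iff)
  next
    assume "c = d \<and> 2 * c \<le> -1 \<and> (a = c + 1 \<and> b = d \<or> a = c \<and> b = d - 1)"
    then show ?thesis unfolding branch_cut_def
      by (intro exI[of _ "-c"]) (auto simp: doubleton_eq_iff)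
  qed
qed

lemma not_cut_0: "\<not> branch_cut 0 w" "\<not> branch_cut w 0" for w :: point
proof -
  obtain a b where "w = (a, b)" by (cases w)
  then show "\<not> branch_cut 0 w" "\<not> branch_cut w 0"
    by (simp_all add: zero_prod_def branch_cut_iff)
qed

lemma zipper_iff_cut:
  assumes "v \<in> Z2" "w \<in> Z2"
  shows "{v, w} \<in> zipper \<longleftrightarrow> branch_cut v w"
proof
  assume "{v, w} \<in> zipper"
  then obtain k :: int where "k \<ge> 1"
    "{v, w} = {(- of_int k, - of_int k), (- of_int k + 1, - of_int k)} \<or>
     {v, w} = {(- of_int k, - of_int k), (- of_int k, - of_int k - 1)}"
    unfolding zipper_def by blast
  then show "branch_cut v w"
    unfolding branch_cut_def by (intro exI[of _ "of_int k"]) auto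
next
  assume "branch_cut v w"
  then obtain k :: real where k: "2 * k \<ge> 1"
    "{v, w} = {(-k, -k), (-k + 1, -k)} \<or> {v, w} = {(-k, -k), (-k, -k - 1)}"
    unfolding branch_cut_def by blast
  then have "(-k, -k) \<in> {v, w}" by blast
  then have "-k \<in> \<int>" using assms by (auto simp: Z2_def)
  then obtain j :: int where j: "k = of_int j"
    by (metis Ints_cases minus_equation_iff of_int_minus)
  then have "j \<ge> 1" using k(1) by linarith
  then show "{v, w} \<in> zipper"
    using k(2) j unfolding zipper_def by (intro UN_I[of j]) auto
qed

lemma cover_adj_lift:
  assumes "nn z w"
  shows "cover_adj (principal_lift z) (principal_lift w) \<longleftrightarrow> \<not> branch_cut z w"
  using assms not_cut_0(1)[of w] not_cut_0(2)[of z]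
  by   (auto simp: cover_adj_def principal_lift_def cover_proj_def)

lemma cover_adj_sym: "cover_adj v w \<longleftrightarrow> cover_adj w v"
  unfolding cover_adj_def nn_def branch_cut_def by (auto simp: insert_commute abs_minus_commute)

lemma cover_adj_swap: "cover_adj (sheet_swap v) (sheet_swap w) \<longleftrightarrow> cover_adj v w"
  by (auto simp: cover_adj_def sheet_swap_def cover_proj_def)

text \<open>Away from the branch vertex the projection is a local isomorphism; all 8 lifts of the
  neighbours of \<open>0\<close> are adjacent to the branch vertex.\<close>

lemma proj_bij_betw_nbrs:
  assumes "cover_proj v \<noteq> 0"
  shows "bij_betw cover_proj (cover_nbrs L v) {z \<in> L. nn (cover_proj v) z}"
  unfolding bij_betw_def
proof
  show "inj_on cover_proj (cover_nbrs L v)"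
    using assms by (auto simp: inj_on_def cover_nbrs_def cover_def cover_adj_def cover_proj_def)
  show "cover_proj ` cover_nbrs L v = {z \<in> L. nn (cover_proj v) z}"
  proof (intro subset_antisym subsetI)
    fix z assume "z \<in> {z \<in> L. nn (cover_proj v) z}"
    then have "(z, if z = 0 then True else snd v = (\<not> branch_cut (cover_proj v) z)) \<in> cover_nbrs L v"
      by (auto simp: cover_nbrs_def cover_def cover_adj_def cover_proj_def)
    then show "z \<in> cover_proj ` cover_nbrs L v"
      by (force simp: cover_proj_def)
  qed (auto simp: cover_nbrs_def cover_def cover_adj_def cover_proj_def)
qed

lemma cover_nbrs_branch: "cover_nbrs L (0, True) = {z \<in> L. nn 0 z} \<times> UNIV"
  by (auto simp: cover_nbrs_def cover_def cover_adj_def cover_proj_def nn_def)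

lemma Ints_eq_pm1: "x \<in> {-1, 0, 1}" if "x \<in> \<int>" "\<bar>x\<bar> \<le> 1" for x :: real
  using that by (elim Ints_cases) (auto simp: abs_le_iff)

lemma nn_nbrs:
  assumes "L = Z2 \<or> L = H2" "(a, b) \<in> L"
  shows "{z \<in> L. nn (a, b) z} = {(a + 1, b), (a - 1, b), (a, b + 1), (a, b - 1)}"
proof (intro subset_antisym subsetI)
  fix z assume z: "z \<in> {z \<in> L. nn (a, b) z}"
  obtain c d where cd: "z = (c, d)" by (cases z)
  have "c - a \<in> \<int>" "d - b \<in> \<int>"
    using z cd assms Ints_diff[of "c - 1/2" "a - 1/2"] Ints_diff[of "d - 1/2" "b - 1/2"]
    by (auto simp: Z2_def H2_def)
  moreover have n: "\<bar>c - a\<bar> + \<bar>d - b\<bar> = 1"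
    using z cd by (simp add: nn_def abs_minus_commute)
  ultimately have "c - a \<in> {-1, 0, 1}" "d - b \<in> {-1, 0, 1}"
    by (intro Ints_eq_pm1; simp; fail)+
  with n show "z \<in> {(a + 1, b), (a - 1, b), (a, b + 1), (a, b - 1)}"
    by (auto simp: cd algebra_simps)
next
  fix z assume "z \<in> {(a + 1, b), (a - 1, b), (a, b + 1), (a, b - 1)}"
  moreover have "x + 1 - 1/2 \<in> \<int>" "x - 1 - 1/2 \<in> \<int>" if "x - 1/2 \<in> \<int>" for x :: real
    using Ints_add[OF that Ints_1] Ints_diff[OF that Ints_1] by (simp_all add: algebra_simps)
  ultimately show "z \<in> {z \<in> L. nn (a, b) z}"
    using assms by (auto simp: Z2_def H2_def nn_def)
qed

lemma card_nbrs_branch: "card (cover_nbrs Z2 (0, True)) = 8"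
proof -
  have "{z \<in> Z2. nn 0 z} = {(1, 0), (-1, 0), (0, 1), (0, -1)}"
    using nn_nbrs[of Z2 0 0] by (simp add: Z2_def zero_prod_def)
  then show ?thesis
    by (simp add: cover_nbrs_branch card_cartesian_product)
qed

text \<open>Monodromy. Going once round a face interchanges the sheets exactly when the cut crosses the
  boundary of the face an odd number of times. In \<open>H2\<close> this happens only for the face centred
  at the origin. In \<open>Z2\<close> it happens for no face away from the branch vertex, while it does
  happen for the 8-cycle surrounding the branch vertex.\<close>

definition odd_face :: "point \<Rightarrow> bool" where
  "odd_face z \<longleftrightarrow>
     ((branch_cut z (z + (1, 0)) \<noteq> branch_cut (z + (1, 0)) (z + (1, 1))) \<noteq>
      (branch_cut (z + (1, 1)) (z + (0, 1)) \<noteq> branch_cut (z + (0, 1)) z))"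

lemma odd_face_H2:
  assumes "z \<in> H2"
  shows "odd_face z \<longleftrightarrow> z = (-1/2, -1/2)"
proof -
  obtain i j :: int where "fst z - 1/2 = of_int i" "snd z - 1/2 = of_int j"
    using assms by (cases z) (auto simp: H2_def Z2_def elim!: Ints_cases)
  then have "z = (of_int i + 1/2, of_int j + 1/2)"
    by (auto simp: prod_eq_iff algebra_simps)
  moreover have "1 + real_of_int i = 0 \<longleftrightarrow> i = -1" "1 + real_of_int j = 0 \<longleftrightarrow> j = -1"
    "2 + 2 * real_of_int i \<le> 0 \<longleftrightarrow> i \<le> -1" "4 + 2 * real_of_int j \<le> 0 \<longleftrightarrow> j \<le> -2"
    by linarith+
  ultimately show ?thesis
    unfolding odd_face_def by (simp add: branch_cut_iff) presburger
qed

lemma not_odd_face_Z2: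
  assumes "z \<in> Z2" "0 \<notin> {z, z + (1, 0), z + (1, 1), z + (0, 1)}"
  shows "\<not> odd_face z"
proof -
  obtain i j :: int where "z = (of_int i, of_int j)"
    using assms by (cases z) (auto simp: Z2_def elim!: Ints_cases)
  moreover have "real_of_int i + 1 = 0 \<longleftrightarrow> i = -1" "real_of_int j + 1 = 0 \<longleftrightarrow> j = -1"
    "2 * real_of_int i \<le> -1 \<longleftrightarrow> i \<le> -1" "3 + 2 * real_of_int j \<le> 0 \<longleftrightarrow> j \<le> -2"
    by linarith+
  ultimately show ?thesis using assms(2)
    unfolding odd_face_def by (simp add: branch_cut_iff zero_prod_def) presburger
qed

lemma ring_around_branch_vertex:
  "branch_cut (-1, -1) (0, -1)" "\<not> branch_cut (0, -1) (1, -1)"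
  "\<not> branch_cut (1, -1) (1, 0)" "\<not> branch_cut (1, 0) (1, 1)"
  "\<not> branch_cut (1, 1) (0, 1)" "\<not> branch_cut (0, 1) (-1, 1)"
  "\<not> branch_cut (-1, 1) (-1, 0)" "\<not> branch_cut (-1, 0) (-1, -1)"
  by (simp_all add: branch_cut_iff)

end

theory Submission
  imports Defs
begin

text \<open>A function on a box of a double cover splits into a part symmetric under the exchange of the
  sheets and an antisymmetric part. In the coordinate of the base, the Laplacian acts on the
  symmetric part as the plain Laplacian, and on the antisymmetric part as the Laplacian with
  conductance \<open>-1\<close> on the edges crossed by the cut; at a branch vertex the antisymmetric part
  vanishes. The Green's function of the box of the cover is therefore half of \<open>S + \<epsilon> A\<close>, where
  \<open>S\<close> is the plain Dirichlet Green's function of the projected box and \<open>A\<close> the signed one, with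
  the origin as an additional Dirichlet vertex if it is a branch vertex
  (\<open>lattice_model.cover_green_n_vert\<close>). Removing the origin from the domain of a Green's function
  is the rank one correction in the formula for \<open>\<Sigma>\<close> (\<open>signed_lattice.green_remove_point\<close>).
  Subtracting the values at the two lifts of \<open>v\<close> cancels \<open>S\<close> and leaves \<open>\<epsilon> A\<close>.

  What remains is that all limits exist, which is where the analysis lies. Both Laplacians are
  positive definite on functions of finite support, so the quadratic form of the Green's function
  increases with the domain; it converges as soon as it is bounded, and the limit is then the same
  along all sequences of domains that differ from the boxes by a bounded amount
  (\<open>signed_lattice.quad_converges\<close>). This matters because the boxes for \<open>\<Xi>\<close> become \<open>[-n,n-1]\<^sup>2\<close>
  after the shift by \<open>(1/2,1/2)\<close>, whereas \<open>G_Z\<close> uses \<open>[-n,n]\<^sup>2\<close>.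

  For the signed Laplacian the form is bounded: along the four edges of the face at which the cut
  starts the product of the conductances is \<open>-1\<close>, so the energy controls the value of a function
  at the origin, and hence everywhere (\<open>zip_green_converges\<close>). For the plain Laplacian the energy
  controls only differences, and the Green's function diverges. Its form is bounded on the charge
  \<open>\<delta>\<^sub>p - \<delta>\<^sub>q\<close>, so the limit of \<open>S(p,q) - S(p,p)\<close> exists once \<open>S(q,q) - S(p,p)\<close> tends to \<open>0\<close>.
  The latter compares the values at the origin for two translates of the same box, which lie
  between two centred boxes of nearly the same size. So it suffices that \<open>g(n+1) - g(n)\<close> tends to
  \<open>0\<close>, where \<open>g(n)\<close> is the value of \<open>S\<close> at \<open>(0,0)\<close> for \<open>[-n,n]\<^sup>2\<close>. The maximum principle
  bounds this increment by \<open>g(n+1)/(n+2)\<close> (\<open>gdiag_increment\<close>), and an energy estimate gives that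
  \<open>g(n)\<close> is of smaller order than \<open>n\<close> (\<open>gdiag_sublinear\<close>), which yields \<open>free_potential_converges\<close>.\<close>

section \<open>The nearest-neighbour Laplacian with signs\<close>

text \<open>Sites are treated as points; splitting the quantifiers over them into two coordinates would block
  the matching of facts about sites.\<close>

declare split_paired_All [simp del] split_paired_Ex [simp del]

type_synonym site = "int \<times> int"

definition nbrs :: "site \<Rightarrow> site set" where
  "nbrs p = {p + (1, 0), p - (1, 0), p + (0, 1), p - (0, 1)}"

text \<open>With signs \<open>c\<close> on the edges this covers both Laplacians on the base: \<open>c = 1\<close> for the symmetric
  functions on a cover, and \<open>c = -1\<close> across the cut for the antisymmetric ones. Integer coordinates
  serve \<open>Z2\<close> and \<open>H2\<close> at the same time.\<close>

definition lap :: "(site \<Rightarrow> site \<Rightarrow> real) \<Rightarrow> (site \<Rightarrow> real) \<Rightarrow> site \<Rightarrow> real" where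
  "lap c f p = (\<Sum>q\<in>nbrs p. f p - c p q * f q)"

definition vanish_off :: "'a set \<Rightarrow> ('a \<Rightarrow> real) \<Rightarrow> bool" where
  "vanish_off B f \<longleftrightarrow> (\<forall>p. p \<notin> B \<longrightarrow> f p = 0)"

text \<open>For \<open>f\<close> vanishing off \<open>B\<close> this is the sum of \<open>(f p - c p q * f q)\<^sup>2\<close> over all edges of the
  lattice.\<close>

definition energy :: "(site \<Rightarrow> site \<Rightarrow> real) \<Rightarrow> site set \<Rightarrow> (site \<Rightarrow> real) \<Rightarrow> real" where
  "energy c B f = (\<Sum>p\<in>B. f p * lap c f p)"

abbreviation green :: "(site \<Rightarrow> site \<Rightarrow> real) \<Rightarrow> site set \<Rightarrow> site \<Rightarrow> site \<Rightarrow> real" where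
  "green c B \<equiv> dirichlet_green (lap c) B"

lemma vanish_offD: "vanish_off B f \<Longrightarrow> p \<notin> B \<Longrightarrow> f p = 0"
  by (simp add: vanish_off_def)

lemma sum_nbrs:
  "(\<Sum>q\<in>nbrs p. F q) = F (p + (1, 0)) + F (p - (1, 0)) + F (p + (0, 1)) + F (p - (0, 1))"
  for F :: "site \<Rightarrow> real"
  by (cases p) (simp add: nbrs_def algebra_simps)

lemma lap_diff: "lap c (\<lambda>u. f u - g u) p = lap c f p - lap c g p"
  by (simp add: lap_def sum_nbrs algebra_simps)

lemma lap_lincomb: "lap c (\<lambda>u. a * f u + b * g u) p = a * lap c f p + b * lap c g p"
  by (simp add: lap_def sum_nbrs algebra_simps)

lemma dirichlet_green_eqI:
  fixes g :: "'a \<Rightarrow> 'a \<Rightarrow> real"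
  assumes off: "\<And>v w. v \<notin> B \<or> w \<notin> B \<Longrightarrow> g v w = 0"
    and inv: "\<And>v w. v \<in> B \<Longrightarrow> w \<in> B \<Longrightarrow> \<Delta> (\<lambda>u. g u w) v = (if v = w then 1 else 0)"
    and diff: "\<And>f h v. v \<in> B \<Longrightarrow> \<Delta> (\<lambda>u. f u - h u) v = \<Delta> f v - \<Delta> h v"
    and inj: "\<And>f v. vanish_off B f \<Longrightarrow> (\<And>u. u \<in> B \<Longrightarrow> \<Delta> f u = 0) \<Longrightarrow> f v = 0"
  shows "dirichlet_green \<Delta> B = g"
  unfolding dirichlet_green_def
proof (rule the_equality)
  show "(\<forall>v w. v \<notin> B \<or> w \<notin> B \<longrightarrow> g v w = 0) \<and>
    (\<forall>v\<in>B. \<forall>w\<in>B. \<Delta> (\<lambda>u. g u w) v = (if v = w then 1 else 0))"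
    using off inv by blast
  fix h assume h: "(\<forall>v w. v \<notin> B \<or> w \<notin> B \<longrightarrow> h v w = 0) \<and>
    (\<forall>v\<in>B. \<forall>w\<in>B. \<Delta> (\<lambda>u. h u w) v = (if v = w then 1 else 0))"
  have "h v w = g v w" for v w
  proof (cases "w \<in> B")
    case True
    have "h v w - g v w = 0"
    proof (rule inj[of "\<lambda>u. h u w - g u w" v])
      show "vanish_off B (\<lambda>u. h u w - g u w)"
        using h off by (simp add: vanish_off_def)
      show "\<Delta> (\<lambda>u. h u w - g u w) u = 0" if "u \<in> B" for u
        using that True h inv by (simp add: diff)
    qed
    then show ?thesis by simp
  next
    case False
    then show ?thesis using h off by simp
  qed
  then show "h = g" by blast
qed

locale signed_lattice =
  fixes c :: "site \<Rightarrow> site \<Rightarrow> real"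
  assumes c_sym: "c p q = c q p" and c_cases: "c p q = 1 \<or> c p q = -1"
begin

text \<open>Summation by parts: both sums run over the pairs \<open>p\<close>, \<open>p + e\<close> that lie in \<open>B\<close>.\<close>

lemma shift_sum:
  assumes "finite B" "vanish_off B f" "vanish_off B g"
  shows "(\<Sum>p\<in>B. g p * (c p (p + e) * f (p + e))) = (\<Sum>p\<in>B. f p * (c p (p - e) * g (p - e)))"
  by (rule sum.reindex_bij_witness_not_neutral
      [where S' = "{p \<in> B. p + e \<notin> B}" and T' = "{p \<in> B. p - e \<notin> B}"
        and i = "\<lambda>p. p - e" and j = "\<lambda>p. p + e"])
    (use assms c_sym in \<open>auto simp: vanish_offD\<close>)

lemma lap_symmetric:
  assumes "finite B" "vanish_off B f" "vanish_off B g"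
  shows "(\<Sum>p\<in>B. g p * lap c f p) = (\<Sum>p\<in>B. f p * lap c g p)"
proof -
  have *: "(\<Sum>p\<in>B. g p * lap c f p) = 4 * (\<Sum>p\<in>B. g p * f p)
      - ((\<Sum>p\<in>B. g p * (c p (p + (1,0)) * f (p + (1,0)))) + (\<Sum>p\<in>B. g p * (c p (p - (1,0)) * f (p - (1,0)))))
      - ((\<Sum>p\<in>B. g p * (c p (p + (0,1)) * f (p + (0,1)))) + (\<Sum>p\<in>B. g p * (c p (p - (0,1)) * f (p - (0,1)))))"
    for f g
    by (simp add: lap_def sum_nbrs sum_distrib_left flip: sum.distrib sum_subtractf)
      (simp add: algebra_simps)
  show ?thesis
    unfolding *[of f g] *[of g f]
    using shift_sum[OF assms, of "(1,0)"] shift_sum[OF assms, of "(0,1)"]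
      shift_sum[OF assms(1,3,2), of "(1,0)"] shift_sum[OF assms(1,3,2), of "(0,1)"]
    by (simp add: mult.commute)
qed

text \<open>The set \<open>P\<close> contains every \<open>p\<close> for which the edge from \<open>p\<close> to \<open>p + e\<close> meets \<open>B\<close>, so no
  contribution is lost; the identity is the expansion of the square with \<open>c\<^sup>2 = 1\<close>.\<close>

lemma edge_energy:
  assumes "finite P" "B \<subseteq> P" "\<And>p. p + e \<in> B \<Longrightarrow> p \<in> P" "vanish_off B f"
  shows "(\<Sum>p\<in>P. (f p - c p (p + e) * f (p + e))\<^sup>2)
    = (\<Sum>p\<in>B. f p * (2 * f p - c p (p + e) * f (p + e) - c p (p - e) * f (p - e)))"
proof -
  have fin: "finite B" using assms(1,2) finite_subset by blast
  have sq: "(f p - c p (p + e) * f (p + e))\<^sup>2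
      = f p * f p + f (p + e) * f (p + e) - 2 * (f p * (c p (p + e) * f (p + e)))" for p
    using c_cases[of p "p + e"] by (auto simp: power2_eq_square algebra_simps)
  have "(\<Sum>p\<in>P. f p * f p) = (\<Sum>p\<in>B. f p * f p)"
    using assms by (intro sum.mono_neutral_right) (auto simp: vanish_off_def)
  moreover have "(\<Sum>p\<in>P. f (p + e) * f (p + e)) = (\<Sum>p\<in>B. f p * f p)"
    by (rule sum.reindex_bij_witness_not_neutral
      [where S' = "{p \<in> P. p + e \<notin> B}" and T' = "{}"
        and i = "\<lambda>p. p - e" and j = "\<lambda>p. p + e"])
     (use assms fin in \<open>auto simp: vanish_offD\<close>)
  moreover have "(\<Sum>p\<in>P. f p * (c p (p + e) * f (p + e))) = (\<Sum>p\<in>B. f p * (c p (p + e) * f (p + e)))"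
    using assms by (intro sum.mono_neutral_right) (auto simp: vanish_off_def)
  ultimately have "(\<Sum>p\<in>P. (f p - c p (p + e) * f (p + e))\<^sup>2)
      = 2 * (\<Sum>p\<in>B. f p * f p) - 2 * (\<Sum>p\<in>B. f p * (c p (p + e) * f (p + e)))"
    by (simp add: sq sum.distrib sum_subtractf flip: sum_distrib_left)
  also have "\<dots> = 2 * (\<Sum>p\<in>B. f p * f p) - (\<Sum>p\<in>B. f p * (c p (p + e) * f (p + e)))
      - (\<Sum>p\<in>B. f p * (c p (p - e) * f (p - e)))"
    using shift_sum[OF fin assms(4,4), of e] by simp
  also have "\<dots> = (\<Sum>p\<in>B. f p * (2 * f p - c p (p + e) * f (p + e) - c p (p - e) * f (p - e)))"
    by (simp add: sum_distrib_left flip: sum_subtractf) (simp add: algebra_simps)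
  finally show ?thesis .
qed

lemma energy_ge:
  assumes "finite B" "vanish_off B f" "finite P" "finite Q"
  shows "(\<Sum>p\<in>P. (f p - c p (p + (1,0)) * f (p + (1,0)))\<^sup>2)
       + (\<Sum>p\<in>Q. (f p - c p (p + (0,1)) * f (p + (0,1)))\<^sup>2) \<le> energy c B f"
proof -
  define R where "R = P \<union> Q \<union> B \<union> (\<lambda>p. p - (1,0)) ` B \<union> (\<lambda>p. p - (0,1)) ` B"
  have R: "finite R" "B \<subseteq> R" "P \<subseteq> R" "Q \<subseteq> R" using assms by (auto simp: R_def)
  have mem: "p \<in> R" if "p + e \<in> B" "e = (1,0) \<or> e = (0,1)" for p e
  proof -
    have "p = (p + e) - e" by simp
    then have "p \<in> (\<lambda>p. p - e) ` B" using that(1) by blast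
    then show ?thesis using that(2) unfolding R_def by blast
  qed
  have "energy c B f = (\<Sum>p\<in>B. f p * (2 * f p - c p (p + (1,0)) * f (p + (1,0)) - c p (p - (1,0)) * f (p - (1,0))))
     + (\<Sum>p\<in>B. f p * (2 * f p - c p (p + (0,1)) * f (p + (0,1)) - c p (p - (0,1)) * f (p - (0,1))))"
    unfolding energy_def lap_def sum_nbrs
    by (simp flip: sum.distrib) (simp add: algebra_simps)
  also have "\<dots> = (\<Sum>p\<in>R. (f p - c p (p + (1,0)) * f (p + (1,0)))\<^sup>2)
       + (\<Sum>p\<in>R. (f p - c p (p + (0,1)) * f (p + (0,1)))\<^sup>2)"
    using edge_energy[OF R(1,2) mem assms(2), of "(1,0)"]
      edge_energy[OF R(1,2) mem assms(2), of "(0,1)"] by simp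
  finally show ?thesis
    using R by (auto intro!: add_mono sum_mono2)
qed

lemma energy_nonneg: "finite B \<Longrightarrow> vanish_off B f \<Longrightarrow> 0 \<le> energy c B f"
  using energy_ge[of B f "{}" "{}"] by simp

lemma edge_le_energy:
  assumes "finite B" "vanish_off B f"
  shows "\<bar>f p - c p (p + (1,0)) * f (p + (1,0))\<bar> \<le> sqrt (energy c B f)"
    and "\<bar>f p - c p (p + (0,1)) * f (p + (0,1))\<bar> \<le> sqrt (energy c B f)"
  using energy_ge[OF assms, of "{p}" "{}"] energy_ge[OF assms, of "{}" "{p}"]
  by (auto intro!: real_le_rsqrt)

lemma abs_step_le_energy:
  assumes "finite B" "vanish_off B f"
  shows "\<bar>\<bar>f p\<bar> - \<bar>f (p + (1,0))\<bar>\<bar> \<le> sqrt (energy c B f)"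
    and "\<bar>\<bar>f p\<bar> - \<bar>f (p + (0,1))\<bar>\<bar> \<le> sqrt (energy c B f)"
  using edge_le_energy[OF assms, of p] c_cases[of p "p + (1,0)"] c_cases[of p "p + (0,1)"]
  by (auto simp: abs_if split: if_splits)

text \<open>If the energy vanishes then \<open>\<bar>f\<bar>\<close> is constant along every horizontal line, and each such line
  leaves the finite set \<open>B\<close>.\<close>

lemma energy_zero:
  assumes "finite B" "vanish_off B f" "energy c B f \<le> 0"
  shows "f p = 0"
proof -
  have E: "energy c B f = 0" using assms energy_nonneg by force
  have *: "\<bar>f (p + (int k, 0))\<bar> = \<bar>f p\<bar>" for k
  proof (induction k)
    case (Suc k)
    have eq: "p + (int (Suc k), 0) = p + (int k, 0) + (1, 0)" by (cases p) simp
    then show ?case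
      using abs_step_le_energy(1)[OF assms(1,2), of "p + (int k, 0)"] E Suc unfolding eq by simp
  qed (cases p; simp)
  have "inj (\<lambda>k. p + (int k, 0))" by (auto intro!: injI)
  then have "infinite (range (\<lambda>k. p + (int k, 0)))" by (rule range_inj_infinite)
  then have "\<not> range (\<lambda>k. p + (int k, 0)) \<subseteq> B"
    using assms(1) finite_subset by blast
  then obtain k where "p + (int k, 0) \<notin> B" by blast
  then show ?thesis using *[of k] assms(2) by (simp add: vanish_off_def)
qed

lemma lap_injective:
  assumes "finite B" "vanish_off B f" "\<And>u. u \<in> B \<Longrightarrow> lap c f u = 0"
  shows "f p = 0"
  by (rule energy_zero[OF assms(1,2)]) (simp add: energy_def assms(3))

section \<open>Dirichlet Green's functions on finite sets\<close>

text \<open>Induction on \<open>B\<close> with a Schur complement: \<open>h\<close> is the function with value \<open>1\<close> at the new site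
  \<open>b\<close> and harmonic on \<open>B\<close>. By injectivity on \<open>insert b B\<close> its Laplacian at \<open>b\<close> does not vanish,
  so a multiple of \<open>h\<close> corrects the value at \<open>b\<close>.\<close>

lemma lap_surjective:
  assumes "finite B"
  shows "\<exists>f. vanish_off B f \<and> (\<forall>p\<in>B. lap c f p = r p)"
  using assms
proof (induction B arbitrary: r)
  case empty
  then show ?case by (auto simp: vanish_off_def)
next
  case (insert b B)
  define d where "d = (\<lambda>p::site. if p = b then 1 else 0 :: real)"
  obtain k where k: "vanish_off B k" "\<forall>p\<in>B. lap c k p = lap c d p"
    using insert.IH[of "lap c d"] by blast
  define h where "h = (\<lambda>p. d p - k p)"
  have h: "vanish_off (insert b B) h" "h b = 1" "\<forall>p\<in>B. lap c h p = 0"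
    using k insert.hyps by (auto simp: vanish_off_def h_def d_def lap_diff)
  have nz: "lap c h b \<noteq> 0"
    using lap_injective[of "insert b B" h b] h insert.hyps by auto
  obtain f where f: "vanish_off B f" "\<forall>p\<in>B. lap c f p = r p"
    using insert.IH[of r] by blast
  define t where "t = (r b - lap c f b) / lap c h b"
  have "vanish_off (insert b B) (\<lambda>p. 1 * f p + t * h p)"
    using f h by (auto simp: vanish_off_def)
  moreover have "\<forall>p\<in>insert b B. lap c (\<lambda>p. 1 * f p + t * h p) p = r p"
    using f h nz unfolding lap_lincomb by (auto simp: t_def)
  ultimately show ?case by blast
qed

lemma green_char:
  assumes "finite B"
  shows "\<And>p q. p \<notin> B \<or> q \<notin> B \<Longrightarrow> green c B p q = 0"
    and "\<And>p q. p \<in> B \<Longrightarrow> q \<in> B \<Longrightarrow> lap c (\<lambda>u. green c B u q) p = (if p = q then 1 else 0)"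
proof -
  obtain S where S: "\<And>q. vanish_off B (S q)" "\<And>q p. p \<in> B \<Longrightarrow> lap c (S q) p = (if p = q then 1 else 0)"
    using lap_surjective[OF assms, of "\<lambda>p. if p = _ then 1 else 0"] by metis
  define g where "g = (\<lambda>p q. if q \<in> B then S q p else 0)"
  have 1: "g p q = 0" if "p \<notin> B \<or> q \<notin> B" for p q
    using that vanish_offD[OF S(1)[of q], of p] by (auto simp: g_def)
  have 2: "lap c (\<lambda>u. g u q) p = (if p = q then 1 else 0)" if "p \<in> B" "q \<in> B" for p q
    using that S(2) by (simp add: g_def cong: if_cong)
  have "green c B = g"
    by (rule dirichlet_green_eqI) (use 1 2 lap_diff lap_injective[OF assms] in auto)
  then show "\<And>p q. p \<notin> B \<or> q \<notin> B \<Longrightarrow> green c B p q = 0"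
    and "\<And>p q. p \<in> B \<Longrightarrow> q \<in> B \<Longrightarrow> lap c (\<lambda>u. green c B u q) p = (if p = q then 1 else 0)"
    using 1 2 by auto
qed

lemma green_vanish: "finite B \<Longrightarrow> vanish_off B (\<lambda>u. green c B u q)"
  by (simp add: vanish_off_def green_char(1))

lemma green_unique:
  assumes "finite B" "vanish_off B f" "q \<in> B"
    "\<And>p. p \<in> B \<Longrightarrow> lap c f p = (if p = q then 1 else 0)"
  shows "f p = green c B p q"
  using lap_injective[of B "\<lambda>u. f u - green c B u q" p] assms green_vanish[OF assms(1), of q]
  by (simp add: vanish_off_def lap_diff green_char(2))

lemma green_sum:
  assumes "finite B" "q \<in> B"
  shows "(\<Sum>p\<in>B. f p * lap c (\<lambda>u. green c B u q) p) = f q"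
proof -
  have "(\<Sum>p\<in>B. f p * lap c (\<lambda>u. green c B u q) p) = (\<Sum>p\<in>B. if p = q then f q else 0)"
    using assms by (intro sum.cong) (auto simp: green_char(2))
  then show ?thesis using assms by simp
qed

lemma green_sym:
  assumes "finite B"
  shows "green c B p q = green c B q p"
proof (cases "p \<in> B \<and> q \<in> B")
  case True
  have "(\<Sum>u\<in>B. green c B u p * lap c (\<lambda>u. green c B u q) u)
      = (\<Sum>u\<in>B. green c B u q * lap c (\<lambda>u. green c B u p) u)"
    by (rule lap_symmetric) (use assms green_vanish in auto)
  then show ?thesis using True assms by (simp add: green_sum)
qed (use assms in \<open>auto simp: green_char(1)\<close>)

lemma green_energy:
  assumes "finite B" "p \<in> B" "q \<in> B"
  shows "energy c B (\<lambda>u. a * green c B u p + b * green c B u q)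
    = a\<^sup>2 * green c B p p + 2 * a * b * green c B p q + b\<^sup>2 * green c B q q" (is "energy c B ?f = _")
proof -
  have "energy c B ?f = a * (\<Sum>u\<in>B. ?f u * lap c (\<lambda>u. green c B u p) u)
      + b * (\<Sum>u\<in>B. ?f u * lap c (\<lambda>u. green c B u q) u)"
    unfolding energy_def lap_lincomb sum_distrib_left
    by (simp flip: sum.distrib) (simp add: algebra_simps)
  also have "\<dots> = a * ?f p + b * ?f q"
    using green_sum[OF assms(1,2), of ?f] green_sum[OF assms(1,3), of ?f] by simp
  also have "\<dots> = a\<^sup>2 * green c B p p + 2 * a * b * green c B p q + b\<^sup>2 * green c B q q"
    using green_sym[OF assms(1), of p q] by (simp add: power2_eq_square algebra_simps)
  finally show ?thesis .
qed

text \<open>With \<open>f\<close> and \<open>f'\<close> the potentials of the charge \<open>\<rho> = a \<delta>\<^sub>p + b \<delta>\<^sub>q\<close> on \<open>B\<close> and \<open>B'\<close>, the mixed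
  energy of \<open>f\<close> and \<open>f'\<close> is the pairing of \<open>\<rho>\<close> with \<open>f\<close>, hence equal to the energy of \<open>f\<close>. So the
  energy of \<open>f' - f\<close>, which is nonnegative, is the difference of the two energies.\<close>

lemma green_energy_mono:
  assumes "finite B'" "B \<subseteq> B'" "p \<in> B" "q \<in> B"
  shows "energy c B (\<lambda>u. a * green c B u p + b * green c B u q)
    \<le> energy c B' (\<lambda>u. a * green c B' u p + b * green c B' u q)" (is "energy c B ?f \<le> energy c B' ?f'")
proof -
  have fin: "finite B" using assms finite_subset by blast
  have B': "p \<in> B'" "q \<in> B'" using assms by auto
  have f: "vanish_off B ?f" "vanish_off B' ?f'"
    using assms(1) fin by (simp_all add: vanish_off_def green_char(1))
  then have f2: "vanish_off B' ?f"
    using assms(2) unfolding vanish_off_def by blast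
  have sf: "(\<Sum>u\<in>B'. g u * lap c ?f' u) = a * g p + b * g q" for g
    unfolding lap_lincomb using green_sum[OF assms(1) B'(1), of g] green_sum[OF assms(1) B'(2), of g]
    by (simp add: algebra_simps sum.distrib flip: sum_distrib_left)
  have ff: "(\<Sum>u\<in>B. g u * lap c ?f u) = a * g p + b * g q" for g
    unfolding lap_lincomb using green_sum[OF fin assms(3), of g] green_sum[OF fin assms(4), of g]
    by (simp add: algebra_simps sum.distrib flip: sum_distrib_left)
  have ext: "(\<Sum>u\<in>B'. ?f u * lap c ?f u) = (\<Sum>u\<in>B. ?f u * lap c ?f u)"
    using assms(1,2) vanish_offD[OF f(1)] by (intro sum.mono_neutral_right) auto
  have "vanish_off B' (\<lambda>u. ?f' u - ?f u)" using f(2) f2 by (simp add: vanish_off_def)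
  then have "0 \<le> energy c B' (\<lambda>u. ?f' u - ?f u)" by (rule energy_nonneg[OF assms(1)])
  also have "\<dots> = (\<Sum>u\<in>B'. ?f' u * lap c ?f' u) - (\<Sum>u\<in>B'. ?f u * lap c ?f' u)
     - (\<Sum>u\<in>B'. ?f' u * lap c ?f u) + (\<Sum>u\<in>B'. ?f u * lap c ?f u)"
    unfolding energy_def lap_diff
    by (simp flip: sum.distrib sum_subtractf) (simp add: algebra_simps)
  also have "(\<Sum>u\<in>B'. ?f' u * lap c ?f u) = (\<Sum>u\<in>B'. ?f u * lap c ?f' u)"
    by (rule lap_symmetric[OF assms(1) f2 f(2)])
  also have "\<dots> = (\<Sum>u\<in>B. ?f u * lap c ?f u)" unfolding sf ff ..
  finally show ?thesis unfolding ext unfolding energy_def by simp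
qed

lemma green_diag_pos:
  assumes "finite B" "p \<in> B"
  shows "0 < green c B p p"
proof (rule ccontr)
  assume "\<not> 0 < green c B p p"
  then have "energy c B (\<lambda>u. green c B u p) \<le> 0"
    using green_energy[OF assms assms(2), of 1 0] by simp
  then have "\<And>u. green c B u p = 0"
    by (rule energy_zero[OF assms(1) green_vanish[OF assms(1)]])
  then have "lap c (\<lambda>u. green c B u p) p = 0" by (simp add: lap_def)
  then show False using green_char(2)[OF assms assms(2)] by simp
qed

text \<open>The right-hand side vanishes at \<open>p = x\<close>, and the correction term is harmonic in
  \<open>B - {x}\<close>, so by uniqueness the difference is the Green's function of \<open>B - {x}\<close>.\<close>

lemma green_remove_point:
  assumes fin: "finite B" and o: "x \<in> B"
  shows "green c (B - {x}) p q = green c B p q - green c B p x * green c B x q / green c B x x"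
proof -
  have nz: "green c B x x \<noteq> 0" using green_diag_pos[OF assms] by simp
  show ?thesis
  proof (cases "q \<in> B - {x}")
    case True
    let ?f = "\<lambda>u. 1 * green c B u q + (- (green c B x q / green c B x x)) * green c B u x"
    have "?f p = green c (B - {x}) p q"
    proof (rule green_unique)
      show "vanish_off (B - {x}) ?f"
        using nz fin by (auto simp: vanish_off_def green_char(1))
      show "lap c ?f u = (if u = q then 1 else 0)" if "u \<in> B - {x}" for u
        using that True o fin unfolding lap_lincomb by (simp add: green_char(2))
    qed (use fin True in auto)
    then show ?thesis by (simp add: mult.commute)
  next
    case False
    then show ?thesis
      using nz fin by (cases "q = x") (simp_all add: green_char(1))
  qed
qed

end

section \<open>Limits along sequences of boxes\<close>

definition bx :: "nat \<Rightarrow> site set" where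
  "bx n = {- int n..int n} \<times> {- int n..int n}"

text \<open>For \<open>n < K\<close> the truncated difference \<open>n - K\<close> is \<open>0\<close>, and a translate of a small box need not
  even contain \<open>bx 0\<close>; hence the restriction to \<open>n \<ge> K\<close>.\<close>

definition near_boxes :: "(nat \<Rightarrow> site set) \<Rightarrow> bool" where
  "near_boxes B \<longleftrightarrow> (\<exists>K. \<forall>n\<ge>K. bx (n - K) \<subseteq> B n \<and> B n \<subseteq> bx (n + K))"

lemma finite_bx [simp]: "finite (bx n)"
  by (simp add: bx_def)

lemma mem_bx: "p \<in> bx n \<longleftrightarrow> \<bar>fst p\<bar> \<le> int n \<and> \<bar>snd p\<bar> \<le> int n"
  by (cases p) (auto simp: bx_def abs_le_iff)

lemma bx_mono: "m \<le> n \<Longrightarrow> bx m \<subseteq> bx n"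
  by (auto simp: mem_bx)

lemma near_boxes_bx: "near_boxes bx"
  unfolding near_boxes_def by (intro exI[of _ 0]) simp

lemma ex_mem_bx: "\<exists>n. p \<in> bx n"
  by (rule exI[of _ "nat (\<bar>fst p\<bar> + \<bar>snd p\<bar>)"]) (simp add: mem_bx)

lemma eventually_near_boxes:
  assumes "near_boxes B"
  shows "\<exists>m. \<forall>n\<ge>m. finite (B n) \<and> p \<in> B n \<and> q \<in> B n"
proof -
  obtain K where K: "\<And>n. n \<ge> K \<Longrightarrow> bx (n - K) \<subseteq> B n \<and> B n \<subseteq> bx (n + K)"
    using assms unfolding near_boxes_def by blast
  obtain a b where ab: "p \<in> bx a" "q \<in> bx b" using ex_mem_bx by metis
  have "finite (B n) \<and> p \<in> B n \<and> q \<in> B n" if "n \<ge> K + a + b" for n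
  proof -
    have "a \<le> n - K" "b \<le> n - K" "n \<ge> K" using that by auto
    then show ?thesis
      using K[of n] bx_mono[of a "n - K"] bx_mono[of b "n - K"] ab finite_subset[OF _ finite_bx] by blast
  qed
  then show ?thesis by blast
qed

text \<open>Used with \<open>F = f\<close> for the plain Laplacian and with \<open>F = \<bar>f\<bar>\<close> in the presence of signs, where only
  absolute values can be compared along a path.\<close>

lemma lipschitz_site:
  fixes F :: "site \<Rightarrow> real"
  assumes 1: "\<And>p. \<bar>F (p + (1,0)) - F p\<bar> \<le> D" and 2: "\<And>p. \<bar>F (p + (0,1)) - F p\<bar> \<le> D"
  shows "\<bar>F p - F q\<bar> \<le> real_of_int (\<bar>fst p - fst q\<bar> + \<bar>snd p - snd q\<bar>) * D"
proof -
  have line: "\<bar>h j - h i\<bar> \<le> \<bar>j - i\<bar> * D" if h: "\<And>i::int. \<bar>h (i + 1) - h i\<bar> \<le> D" for h :: "int \<Rightarrow> real" and i j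
  proof -
    have up: "\<bar>h (i + int k) - h i\<bar> \<le> k * D" for i k
    proof (induction k)
      case (Suc k)
      have "i + int (Suc k) = (i + int k) + 1" by simp
      then show ?case using Suc h[of "i + int k"] by (simp add: algebra_simps)
    qed simp
    show ?thesis
    proof (cases "i \<le> j")
      case True
      then show ?thesis using up[of i "nat (j - i)"] by simp
    next
      case False
      then show ?thesis using up[of j "nat (i - j)"] by (simp add: abs_minus_commute)
    qed
  qed
  obtain a b x y where pq: "p = (a, b)" "q = (x, y)" by (cases p; cases q) auto
  have "\<bar>F (a, b) - F (x, b)\<bar> \<le> \<bar>a - x\<bar> * D"
    using line[of "\<lambda>i. F (i, b)"] 1[of "(_, b)"] by simp
  moreover have "\<bar>F (x, b) - F (x, y)\<bar> \<le> \<bar>b - y\<bar> * D"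
    using line[of "\<lambda>i. F (x, i)"] 2[of "(x, _)"] by simp
  ultimately show ?thesis by (simp add: pq algebra_simps)
qed

context signed_lattice
begin

text \<open>The quadratic form of the Green's function on the charge \<open>a \<delta>\<^sub>p + b \<delta>\<^sub>q\<close>.\<close>

definition quad :: "site set \<Rightarrow> real \<Rightarrow> real \<Rightarrow> site \<Rightarrow> site \<Rightarrow> real" where
  "quad B a b p q = a\<^sup>2 * green c B p p + 2 * a * b * green c B p q + b\<^sup>2 * green c B q q"

lemma quad_mono:
  assumes "finite B'" "B \<subseteq> B'" "p \<in> B" "q \<in> B"
  shows "quad B a b p q \<le> quad B' a b p q"
proof -
  have "finite B" "p \<in> B'" "q \<in> B'" using assms finite_subset by auto
  then show ?thesis
    using green_energy_mono[OF assms, of a b] assms unfolding quad_def by (simp add: green_energy)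
qed

text \<open>The potential of the charge has energy \<open>quad\<close>, and the functional \<open>a f(p) + b f(q)\<close> evaluates on
  it to \<open>quad\<close> as well, so \<open>quad \<le> C * sqrt quad\<close>.\<close>

lemma quad_bound:
  assumes ctrl: "\<And>B f. finite B \<Longrightarrow> vanish_off B f \<Longrightarrow> \<bar>a * f p + b * f q\<bar> \<le> C * sqrt (energy c B f)"
    and B: "finite B" "p \<in> B" "q \<in> B"
  shows "quad B a b p q \<le> C\<^sup>2"
proof -
  let ?f = "\<lambda>u. a * green c B u p + b * green c B u q"
  have E: "energy c B ?f = quad B a b p q" unfolding quad_def by (rule green_energy[OF B])
  have v: "vanish_off B ?f" using B by (simp add: vanish_off_def green_char(1))
  have nn: "0 \<le> quad B a b p q" using energy_nonneg[OF B(1) v] E by simp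
  have "a * ?f p + b * ?f q = quad B a b p q"
    using green_sym[OF B(1), of q p] by (simp add: quad_def power2_eq_square algebra_simps)
  then have "quad B a b p q \<le> C * sqrt (quad B a b p q)"
    using ctrl[OF B(1) v] unfolding E by simp
  then have "sqrt (quad B a b p q) * sqrt (quad B a b p q) \<le> C * sqrt (quad B a b p q)"
    using nn by simp
  then have "quad B a b p q = 0 \<or> sqrt (quad B a b p q) \<le> C"
    using nn mult_right_le_imp_le[of "sqrt (quad B a b p q)" "sqrt (quad B a b p q)" C]
    by (cases "quad B a b p q = 0") auto
  then show ?thesis
    by (auto dest: sqrt_le_D)
qed

lemma quad_converges:
  assumes ctrl: "\<And>B f. finite B \<Longrightarrow> vanish_off B f \<Longrightarrow> \<bar>a * f p + b * f q\<bar> \<le> C * sqrt (energy c B f)"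
  shows "\<exists>l. \<forall>B. near_boxes B \<longrightarrow> (\<lambda>n. quad (B n) a b p q) \<longlonglongrightarrow> l"
proof -
  define X where "X = (\<lambda>n. quad (bx n) a b p q)"
  obtain m where m: "\<And>n. n \<ge> m \<Longrightarrow> p \<in> bx n \<and> q \<in> bx n"
    using eventually_near_boxes[OF near_boxes_bx] by metis
  have "incseq (\<lambda>n. X (n + m))"
    unfolding X_def by (intro incseq_SucI quad_mono) (use m in \<open>auto intro!: bx_mono\<close>)
  moreover have "X (n + m) \<le> C\<^sup>2" for n
    unfolding X_def using ctrl m by (intro quad_bound) auto
  ultimately obtain l where "(\<lambda>n. X (n + m)) \<longlonglongrightarrow> l"
    by (auto elim!: incseq_convergent)
  then have l: "X \<longlonglongrightarrow> l" by (rule LIMSEQ_offset)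
  have "(\<lambda>n. quad (B n) a b p q) \<longlonglongrightarrow> l" if B: "near_boxes B" for B
  proof -
    obtain K where K: "\<And>n. n \<ge> K \<Longrightarrow> bx (n - K) \<subseteq> B n \<and> B n \<subseteq> bx (n + K)"
      using B unfolding near_boxes_def by blast
    have *: "X (n - K) \<le> quad (B n) a b p q \<and> quad (B n) a b p q \<le> X (n + K)" if n: "n \<ge> m + K" for n
    proof -
      have "p \<in> bx (n - K)" "q \<in> bx (n - K)" using m n by auto
      moreover have "bx (n - K) \<subseteq> B n" "B n \<subseteq> bx (n + K)" using K n by auto
      ultimately show ?thesis
        unfolding X_def using finite_subset[OF _ finite_bx] by (intro conjI quad_mono) auto
    qed
    show ?thesis
    proof (rule tendsto_sandwich)
      show "\<forall>\<^sub>F n in sequentially. X (n - K) \<le> quad (B n) a b p q"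
        using * eventually_at_top_linorder by blast
      show "\<forall>\<^sub>F n in sequentially. quad (B n) a b p q \<le> X (n + K)"
        using * eventually_at_top_linorder by blast
      show "(\<lambda>n. X (n - K)) \<longlonglongrightarrow> l"
        by (rule filterlim_compose[OF l filterlim_minus_const_nat_at_top])
      show "(\<lambda>n. X (n + K)) \<longlonglongrightarrow> l" by (rule LIMSEQ_ignore_initial_segment[OF l])
    qed
  qed
  then show ?thesis by blast
qed

end

section \<open>The signed Laplacian: convergence of the Green's function\<close>

text \<open>In integer coordinates the edges crossed by the cut are the same for both lattices: the shift by
  \<open>(1/2,1/2)\<close> turns the half-integers \<open>k \<ge> 1/2\<close> for \<open>H2\<close> into the integers \<open>k \<ge> 1\<close> for \<open>Z2\<close>.\<close>

definition half_cut :: "site \<Rightarrow> site \<Rightarrow> bool" where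
  "half_cut p q \<longleftrightarrow> fst p = snd p \<and> fst p \<le> -1 \<and> (q = p + (1, 0) \<or> q = p - (0, 1))"

definition site_cut :: "site \<Rightarrow> site \<Rightarrow> bool" where
  "site_cut p q \<longleftrightarrow> half_cut p q \<or> half_cut q p"

definition cut_cond :: "site \<Rightarrow> site \<Rightarrow> real" where
  "cut_cond p q = (if site_cut p q then -1 else 1)"

definition plain_cond :: "site \<Rightarrow> site \<Rightarrow> real" where
  "plain_cond p q = 1"

interpretation zip: signed_lattice cut_cond
  by unfold_locales (auto simp: cut_cond_def site_cut_def)

interpretation free: signed_lattice plain_cond
  by unfold_locales (auto simp: plain_cond_def)

text \<open>Around the face with corners \<open>(-1,-1)\<close> and \<open>(0,0)\<close> exactly one edge is crossed by the cut, so the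
  four edge differences of \<open>f\<close>, taken with suitable signs, add up to \<open>2 f(0)\<close>.\<close>

lemma zip_point_bound_0:
  assumes "finite B" "vanish_off B f"
  shows "\<bar>f 0\<bar> \<le> 2 * sqrt (energy cut_cond B f)"
proof -
  define D where "D = sqrt (energy cut_cond B f)"
  note h = zip.edge_le_energy(1)[OF assms, folded D_def]
  note v = zip.edge_le_energy(2)[OF assms, folded D_def]
  have "\<bar>f (-1,-1) + f (0,-1)\<bar> \<le> D" "\<bar>f (-1,0) - f (0,0)\<bar> \<le> D"
    using h[of "(-1,-1)"] h[of "(-1,0)"] by (auto simp: cut_cond_def site_cut_def half_cut_def)
  moreover have "\<bar>f (-1,-1) - f (-1,0)\<bar> \<le> D" "\<bar>f (0,-1) - f (0,0)\<bar> \<le> D"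
    using v[of "(-1,-1)"] v[of "(0,-1)"] by (auto simp: cut_cond_def site_cut_def half_cut_def)
  ultimately show ?thesis unfolding D_def[symmetric] zero_prod_def by linarith
qed

lemma zip_point_bound:
  assumes "finite B" "vanish_off B f"
  shows "\<bar>f p\<bar> \<le> (2 + real_of_int (\<bar>fst p\<bar> + \<bar>snd p\<bar>)) * sqrt (energy cut_cond B f)"
proof -
  have "\<bar>\<bar>f p\<bar> - \<bar>f 0\<bar>\<bar> \<le> real_of_int (\<bar>fst p - fst (0::site)\<bar> + \<bar>snd p - snd (0::site)\<bar>) * sqrt (energy cut_cond B f)"
    by (rule lipschitz_site[where F = "\<lambda>p. \<bar>f p\<bar>"]) (use zip.abs_step_le_energy[OF assms] in \<open>simp_all add: abs_minus_commute\<close>)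
  then show ?thesis using zip_point_bound_0[OF assms] by (simp add: algebra_simps)
qed

text \<open>Off the diagonal, convergence follows by polarization from the charges \<open>\<delta>\<^sub>p\<close>, \<open>\<delta>\<^sub>q\<close> and
  \<open>\<delta>\<^sub>p + \<delta>\<^sub>q\<close>.\<close>

lemma zip_green_converges:
  "\<exists>l. \<forall>B. near_boxes B \<longrightarrow> (\<lambda>n. green cut_cond (B n) p q) \<longlonglongrightarrow> l"
proof -
  define C where "C = (\<lambda>p::site. 2 + real_of_int (\<bar>fst p\<bar> + \<bar>snd p\<bar>))"
  have b: "\<bar>f p\<bar> \<le> C p * sqrt (energy cut_cond B f)" if "finite B" "vanish_off B f" for B f p
    unfolding C_def by (rule zip_point_bound[OF that])
  obtain l1 where l1: "\<And>B. near_boxes B \<Longrightarrow> (\<lambda>n. zip.quad (B n) 1 0 p q) \<longlonglongrightarrow> l1"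
    using zip.quad_converges[of 1 p 0 q "C p"] b by auto
  obtain l2 where l2: "\<And>B. near_boxes B \<Longrightarrow> (\<lambda>n. zip.quad (B n) 0 1 p q) \<longlonglongrightarrow> l2"
    using zip.quad_converges[of 0 p 1 q "C q"] b by auto
  have "\<bar>1 * f p + 1 * f q\<bar> \<le> (C p + C q) * sqrt (energy cut_cond B f)" if "finite B" "vanish_off B f" for B f
    using b[OF that, of p] b[OF that, of q] by (simp add: algebra_simps)
  then obtain l3 where l3: "\<And>B. near_boxes B \<Longrightarrow> (\<lambda>n. zip.quad (B n) 1 1 p q) \<longlonglongrightarrow> l3"
    using zip.quad_converges[of 1 p 1 q "C p + C q"] by auto
  have "(\<lambda>n. green cut_cond (B n) p q) \<longlonglongrightarrow> (l3 - l1 - l2) / 2" if "near_boxes B" for B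
  proof -
    have "(\<lambda>n. (zip.quad (B n) 1 1 p q - zip.quad (B n) 1 0 p q - zip.quad (B n) 0 1 p q) / 2)
        \<longlonglongrightarrow> (l3 - l1 - l2) / 2"
      using that l1 l2 l3 by (intro tendsto_intros) auto
    then show ?thesis by (simp add: zip.quad_def)
  qed
  then show ?thesis by blast
qed

section \<open>The plain Laplacian: convergence of the potential kernel\<close>

lemma lap_plain: "lap plain_cond f p = (\<Sum>q\<in>nbrs p. f p - f q)"
  by (simp add: lap_def plain_cond_def)

text \<open>The truncation \<open>h\<close> of \<open>f - M\<close> to its positive part on \<open>B\<close> has nonpositive energy, hence is zero.\<close>

lemma max_principle:
  assumes fin: "finite B" and sub: "\<And>p. p \<in> B \<Longrightarrow> lap plain_cond f p \<le> 0"
    and bd: "\<And>p q. p \<in> B \<Longrightarrow> q \<in> nbrs p \<Longrightarrow> q \<notin> B \<Longrightarrow> f q \<le> M"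
    and p: "p \<in> B"
  shows "f p \<le> M"
proof -
  define h where "h = (\<lambda>p. if p \<in> B then max 0 (f p - M) else 0)"
  have v: "vanish_off B h" by (simp add: vanish_off_def h_def)
  have "h p * lap plain_cond h p \<le> 0" if p: "p \<in> B" for p
  proof (cases "h p = 0")
    case False
    then have hp: "h p = f p - M" "h p > 0" using p False by (auto simp: h_def max_def split: if_splits)
    have "f q - M \<le> h q" if "q \<in> nbrs p" for q
      using bd[OF p that] by (auto simp: h_def)
    then have "lap plain_cond h p \<le> lap plain_cond f p"
      unfolding lap_plain hp(1) by (intro sum_mono) fastforce
    also have "\<dots> \<le> 0" by (rule sub[OF p])
    finally show ?thesis using hp(2) by (simp add: mult_nonneg_nonpos)
  qed simp
  then have "energy plain_cond B h \<le> 0" unfolding energy_def by (rule sum_nonpos)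
  then have "h p = 0" by (rule free.energy_zero[OF fin v])
  then show ?thesis using p by (simp add: h_def max_def split: if_splits)
qed

definition gdiag :: "nat \<Rightarrow> real" where
  "gdiag n = green plain_cond (bx n) 0 0"

lemma zero_bx: "0 \<in> bx n"
  by (simp add: mem_bx)

lemma gdiag_mono: "m \<le> n \<Longrightarrow> gdiag m \<le> gdiag n"
  using free.quad_mono[OF finite_bx bx_mono[of m n], of 0 0 1 0]
  by (simp add: zero_bx free.quad_def gdiag_def)

lemma gdiag_nonneg: "0 \<le> gdiag n"
  using free.energy_nonneg[OF finite_bx free.green_vanish[OF finite_bx, of n 0]]
    free.green_energy[OF finite_bx zero_bx zero_bx, of n 1 0]
  by (simp add: gdiag_def)

lemma green_le_gdiag: "green plain_cond (bx n) p 0 \<le> gdiag n"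
proof (cases "p \<in> bx n - {0}")
  case True
  show ?thesis
  proof (rule max_principle[OF _ _ _ True])
    show "lap plain_cond (\<lambda>u. green plain_cond (bx n) u 0) q \<le> 0" if "q \<in> bx n - {0}" for q
      using that zero_bx by (simp add: free.green_char(2))
    show "green plain_cond (bx n) q 0 \<le> gdiag n" if "q \<notin> bx n - {0}" for q
      using that gdiag_nonneg by (cases "q = 0") (auto simp: gdiag_def free.green_char(1))
  qed simp
next
  case False
  then show ?thesis
    using gdiag_nonneg by (cases "p = 0") (auto simp: gdiag_def free.green_char(1))
qed

lemma nbrs_iff: "q \<in> nbrs p \<longleftrightarrow> (fst q = fst p \<and> \<bar>snd q - snd p\<bar> = 1) \<or> (snd q = snd p \<and> \<bar>fst q - fst p\<bar> = 1)"
  by (cases p; cases q) (auto simp: nbrs_def abs_if)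

text \<open>In the half of the box with \<open>\<alpha> x + \<beta> y \<ge> 1\<close> the Green's function is compared with the linear, hence
  harmonic, function that equals \<open>gdiag n\<close> on the line through the origin and \<open>0\<close> just outside the
  opposite side. At sites next to that side the bound gains the factor \<open>1/(n+1)\<close>.\<close>

lemma green_linear_bound:
  fixes \<alpha> \<beta> :: int
  assumes ab: "(\<alpha>, \<beta>) \<in> {(1,0), (-1,0), (0,1), (0,-1)}"
    and p: "p \<in> bx n" "\<alpha> * fst p + \<beta> * snd p \<ge> 1"
  shows "green plain_cond (bx n) p 0 \<le> gdiag n * (int n + 1 - (\<alpha> * fst p + \<beta> * snd p)) / (n + 1)"
proof -
  define l where "l = (\<lambda>p::site. \<alpha> * fst p + \<beta> * snd p)"
  define k where "k = gdiag n / (n + 1)"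
  define L where "L = (\<lambda>p. k * real_of_int (int n + 1 - l p))"
  define B where "B = {p \<in> bx n. l p \<ge> 1}"
  have l_lap: "lap plain_cond L p = 0" for p
    unfolding lap_plain sum_nbrs L_def l_def by (simp add: algebra_simps)
  have l_nbr: "\<bar>l q - l p\<bar> \<le> 1" if "q \<in> nbrs p" for p q
    using that ab by (auto simp: l_def nbrs_iff)
  have l_bx: "l p \<le> int n" if "p \<in> bx n" for p
    using that ab by (auto simp: l_def mem_bx)
  have "green plain_cond (bx n) p 0 - L p \<le> 0"
  proof (rule max_principle[where B = B])
    show "finite B" by (simp add: B_def)
    show "p \<in> B" using p by (simp add: B_def l_def)
    show "lap plain_cond (\<lambda>u. green plain_cond (bx n) u 0 - L u) p \<le> 0" if "p \<in> B" for p
      using that zero_bx unfolding lap_diff l_lap by (auto simp: B_def l_def free.green_char(2))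
    show "green plain_cond (bx n) q 0 - L q \<le> 0" if "p \<in> B" "q \<in> nbrs p" "q \<notin> B" for p q
    proof (cases "q \<in> bx n")
      case True
      then have "l q = 0" using that l_nbr[OF that(2)] by (auto simp: B_def)
      then have "L q = gdiag n" by (simp add: L_def k_def add.commute[of 1])
      then show ?thesis using green_le_gdiag[of n q] by simp
    next
      case False
      have "l q \<le> int n + 1" using l_nbr[OF that(2)] l_bx[of p] that(1) by (auto simp: B_def)
      then have "0 \<le> L q" unfolding L_def k_def using gdiag_nonneg[of n] by (intro mult_nonneg_nonneg) auto
      then show ?thesis using False by (simp add: free.green_char(1))
    qed
  qed
  then show ?thesis by (simp add: L_def l_def k_def)
qed

text \<open>The difference of the Green's functions of two successive boxes is harmonic in the smaller one, and
  on its outer boundary it is the Green's function of the larger box next to the sides of that box.\<close>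

lemma gdiag_increment: "gdiag (Suc n) - gdiag n \<le> gdiag (Suc n) / (real n + 2)"
proof -
  have "green plain_cond (bx (Suc n)) 0 0 - green plain_cond (bx n) 0 0 \<le> gdiag (Suc n) / (real n + 2)"
  proof (rule max_principle[where B = "bx n" and p = 0
        and f = "\<lambda>u. green plain_cond (bx (Suc n)) u 0 - green plain_cond (bx n) u 0"])
    show "finite (bx n)" "0 \<in> bx n" by (simp_all add: zero_bx)
    show "lap plain_cond (\<lambda>u. green plain_cond (bx (Suc n)) u 0 - green plain_cond (bx n) u 0) p \<le> 0" if "p \<in> bx n" for p
      using that zero_bx bx_mono[of n "Suc n"] unfolding lap_diff by (auto simp: free.green_char(2))
    show "green plain_cond (bx (Suc n)) q 0 - green plain_cond (bx n) q 0 \<le> gdiag (Suc n) / (real n + 2)"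
      if "p \<in> bx n" "q \<in> nbrs p" "q \<notin> bx n" for p q
    proof -
      have q: "q \<in> bx (Suc n)" using that by (auto simp: mem_bx nbrs_iff)
      have "fst q = int (Suc n) \<or> - fst q = int (Suc n) \<or> snd q = int (Suc n) \<or> - snd q = int (Suc n)"
        using that(3) q by (auto simp: mem_bx)
      then obtain \<alpha> \<beta> :: int where ab: "(\<alpha>, \<beta>) \<in> {(1,0), (-1,0), (0,1), (0,-1)}"
        "\<alpha> * fst q + \<beta> * snd q = int (Suc n)" 
        by (elim disjE) (force+)
      show ?thesis
        using green_linear_bound[OF ab(1) q] that(3) unfolding ab(2)
        by (simp add: free.green_char(1) add.commute)
    qed
  qed
  then show ?thesis by (simp add: gdiag_def)
qed

text \<open>Let \<open>f\<close> be the Green's function of the box with pole \<open>0\<close>. Its energy is \<open>f 0 = gdiag n\<close>. The value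
  \<open>f 0\<close> differs from each of the \<open>f (0, j)\<close>, \<open>j < N\<close>, by at most \<open>N * sqrt (f 0)\<close>, while the sum of
  these \<open>N\<close> values is a sum of differences along \<open>N (n + 1)\<close> distinct edges, which Cauchy-Schwarz
  bounds by \<open>sqrt (N (n + 1)) * sqrt (f 0)\<close>. Spreading over \<open>N\<close> rows is what gains the factor \<open>1/N\<close>
  over the bound along a single row.\<close>

lemma gdiag_sublinear:
  assumes N: "N \<ge> 1"
  shows "gdiag n \<le> 2 * (real n + 1) / real N + 2 * (real N)\<^sup>2"
proof -
  define f where "f = (\<lambda>u. green plain_cond (bx n) u 0)"
  have v: "vanish_off (bx n) f" unfolding f_def by (rule free.green_vanish) simp
  define D where "D = sqrt (gdiag n)"
  have D: "0 \<le> D" "D\<^sup>2 = gdiag n" using gdiag_nonneg by (simp_all add: D_def)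
  have E: "energy plain_cond (bx n) f = gdiag n"
    using free.green_energy[OF finite_bx zero_bx zero_bx, of n 1 0] by (simp add: f_def gdiag_def)
  have f0: "f 0 = gdiag n" by (simp add: f_def gdiag_def)
  define a where "a = (\<lambda>(j, x). f (int x, int j) - f (int x + 1, int j))"
  have row: "(\<Sum>x<n + 1. a (j, x)) = f (0, int j)" for j
  proof -
    have "(\<Sum>x<n + 1. a (j, x)) = - (\<Sum>x<n + 1. f (int (Suc x), int j) - f (int x, int j))"
      unfolding sum_negf[symmetric] by (intro sum.cong) (auto simp: a_def add.commute)
    also have "\<dots> = f (0, int j) - f (int (n + 1), int j)"
      by (subst sum_lessThan_telescope) simp
    also have "f (int (n + 1), int j) = 0"
      by (rule vanish_offD[OF v]) (simp add: mem_bx)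
    finally show ?thesis by simp
  qed
  have col: "f 0 \<le> f (0, int j) + N * D" if "j < N" for j
  proof -
    have "\<bar>f 0 - f (0, int j)\<bar> \<le> real_of_int (\<bar>fst (0::site) - fst (0::int, int j)\<bar> + \<bar>snd (0::site) - snd (0::int, int j)\<bar>) * D"
      by (rule lipschitz_site)
        (use free.edge_le_energy[OF finite_bx v] E in \<open>simp_all add: plain_cond_def D_def abs_minus_commute\<close>)
    also have "\<dots> = j * D" by simp
    also have "\<dots> \<le> N * D" using that D by (intro mult_right_mono) auto
    finally show ?thesis by linarith
  qed
  let ?I = "{..<N} \<times> {..<n + 1}"
  have "real N * gdiag n = (\<Sum>j<N. f 0)" by (simp add: f0)
  also have "\<dots> \<le> (\<Sum>j<N. f (0, int j) + N * D)" using col by (intro sum_mono) auto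
  also have "\<dots> = (\<Sum>i\<in>?I. a i) + real N * (N * D)"
    unfolding sum.distrib row[symmetric] sum.cartesian_product by simp
  also have "(\<Sum>i\<in>?I. a i) \<le> sqrt (real N * (n + 1)) * D"
  proof -
    have "(\<Sum>i\<in>?I. a i)\<^sup>2 \<le> (\<Sum>i\<in>?I. 1\<^sup>2) * (\<Sum>i\<in>?I. (a i)\<^sup>2)"
      using Cauchy_Schwarz_ineq_sum[of "\<lambda>_. 1" a ?I] by simp
    moreover have "(\<Sum>i\<in>?I. (a i)\<^sup>2) = (\<Sum>p\<in>(\<lambda>(j, x). (int x, int j)) ` ?I. (f p - f (p + (1,0)))\<^sup>2)"
      by (subst sum.reindex) (auto simp: inj_on_def a_def intro!: sum.cong)
    moreover have "\<dots> \<le> gdiag n"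
      using free.energy_ge[OF finite_bx v, of "(\<lambda>(j, x). (int x, int j)) ` ?I" "{}"] by (simp add: E plain_cond_def)
    ultimately have "(\<Sum>i\<in>?I. a i)\<^sup>2 \<le> (\<Sum>i\<in>?I. 1\<^sup>2) * D\<^sup>2"
      unfolding D by (elim order_trans) (intro mult_left_mono, auto)
    then have "(\<Sum>i\<in>?I. a i)\<^sup>2 \<le> (real N * (n + 1)) * D\<^sup>2" by (simp add: algebra_simps)
    then have "\<bar>\<Sum>i\<in>?I. a i\<bar> \<le> sqrt ((real N * (n + 1)) * D\<^sup>2)"
      by (intro real_le_rsqrt) (simp only: power2_abs)
    then show ?thesis using D(1) by (simp add: real_sqrt_mult)
  qed
  finally have *: "real N * D\<^sup>2 \<le> (sqrt (real N * (n + 1)) + (real N)\<^sup>2) * D"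
    unfolding D(2) by (simp add: power2_eq_square algebra_simps)
  have "real N * D \<le> sqrt (real N * (n + 1)) + (real N)\<^sup>2"
  proof (cases "D = 0")
    case False
    then show ?thesis using * D(1) mult_right_le_imp_le[of "real N * D" D]
      by (simp add: power2_eq_square mult.assoc)
  qed simp
  then have "(real N * D)\<^sup>2 \<le> (sqrt (real N * (n + 1)) + (real N)\<^sup>2)\<^sup>2"
    using D by (intro power_mono) auto
  also have "\<dots> \<le> 2 * (real N * (n + 1)) + 2 * ((real N)\<^sup>2)\<^sup>2"
  proof -
    have "(x + y)\<^sup>2 \<le> 2 * x\<^sup>2 + 2 * y\<^sup>2" for x y :: real
      using zero_le_power2[of "x - y"] by (simp add: power2_eq_square algebra_simps)
    from this[of "sqrt (real N * (n + 1))" "(real N)\<^sup>2"] show ?thesis by simp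
  qed
  finally have "real N * (real N * D\<^sup>2) \<le> real N * (2 * (real n + 1) + 2 * real N ^ 3)"
    by (simp add: power_mult_distrib power2_eq_square power3_eq_cube algebra_simps)
  then have "real N * D\<^sup>2 \<le> 2 * (real n + 1) + 2 * real N ^ 3"
    by (rule mult_left_le_imp_le) (use N in simp)
  then show ?thesis
    using N unfolding D(2) by (simp add: power2_eq_square power3_eq_cube field_simps)
qed

lemma gdiag_over_n: "(\<lambda>n. gdiag (Suc n) / (real n + 2)) \<longlonglongrightarrow> 0"
proof (rule LIMSEQ_I)
  fix r :: real assume r: "r > 0"
  obtain N :: nat where N: "4 / r < real N" "N \<ge> 1"
    using reals_Archimedean2[of "max (4 / r) 1"] by fastforce
  obtain M :: nat where M: "4 * (real N)\<^sup>2 / r < M" using reals_Archimedean2 by blast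
  have "norm (gdiag (Suc n) / (real n + 2) - 0) < r" if n: "n \<ge> M" for n
  proof -
    have "gdiag (Suc n) \<le> 2 * (real n + 2) / real N + 2 * (real N)\<^sup>2"
      using gdiag_sublinear[OF N(2), of "Suc n"] by (simp add: add.commute)
    also have "2 * (real n + 2) / real N = 2 / real N * (real n + 2)" by simp
    also have "\<dots> < r / 2 * (real n + 2)"
      using N r by (intro mult_strict_right_mono) (simp_all add: field_simps)
    also have "2 * (real N)\<^sup>2 \<le> r / 2 * (real n + 2)"
    proof -
      have "4 * (real N)\<^sup>2 / r < real n + 2" using M n by linarith
      then show ?thesis using r by (simp add: field_simps)
    qed
    finally have "gdiag (Suc n) < r * (real n + 2)" by (simp add: algebra_simps)
    then show ?thesis using gdiag_nonneg[of "Suc n"] by (simp add: field_simps)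
  qed
  then show "\<exists>no. \<forall>n\<ge>no. norm (gdiag (Suc n) / (real n + 2) - 0) < r" by blast
qed

lemma gdiag_gap: "(\<lambda>n. gdiag (n + k) - gdiag n) \<longlonglongrightarrow> 0"
proof (induction k)
  case (Suc k)
  have "(\<lambda>n. gdiag (Suc n) - gdiag n) \<longlonglongrightarrow> 0"
    by (rule tendsto_sandwich[OF _ _ tendsto_const gdiag_over_n])
      (use gdiag_increment gdiag_mono in auto)
  then have "(\<lambda>n. gdiag (Suc (n + k)) - gdiag (n + k)) \<longlonglongrightarrow> 0"
    by (rule LIMSEQ_ignore_initial_segment)
  from tendsto_add[OF this Suc] show ?case by simp
qed simp

lemma green_translate:
  assumes fin: "finite B" and p: "p \<in> B"
  shows "green plain_cond ((\<lambda>u. u - p) ` B) 0 0 = green plain_cond B p p"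
proof -
  let ?B = "(\<lambda>u. u - p) ` B"
  have mem: "u \<in> ?B \<longleftrightarrow> u + p \<in> B" for u
    by (auto simp: image_iff intro!: bexI[of _ "u + p"])
  have lap_t: "lap plain_cond (\<lambda>u. f (u + p)) u = lap plain_cond f (u + p)" for f u
    by (simp add: lap_plain sum_nbrs algebra_simps)
  have "green plain_cond B (0 + p) p = green plain_cond ?B 0 0"
  proof (rule free.green_unique)
    show "vanish_off ?B (\<lambda>u. green plain_cond B (u + p) p)"
      using fin mem by (simp add: vanish_off_def free.green_char(1))
    show "lap plain_cond (\<lambda>u. green plain_cond B (u + p) p) u = (if u = 0 then 1 else 0)" if "u \<in> ?B" for u
      using lap_t[of "\<lambda>u. green plain_cond B u p" u] that mem free.green_char(2)[OF fin, of "u + p" p] p by simp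
  qed (use fin p mem in auto)
  then show ?thesis by simp
qed

lemma near_boxes_translate:
  assumes "near_boxes B"
  shows "near_boxes (\<lambda>n. (\<lambda>u. u - p) ` B n)"
proof -
  obtain K where K: "\<And>n. n \<ge> K \<Longrightarrow> bx (n - K) \<subseteq> B n \<and> B n \<subseteq> bx (n + K)"
    using assms unfolding near_boxes_def by blast
  define m where "m = nat (\<bar>fst p\<bar> + \<bar>snd p\<bar>)"
  then have m: "int m = \<bar>fst p\<bar> + \<bar>snd p\<bar>" by simp
  have "bx (n - (K + m)) \<subseteq> (\<lambda>u. u - p) ` B n \<and> (\<lambda>u. u - p) ` B n \<subseteq> bx (n + (K + m))" if n: "n \<ge> K + m" for n
  proof (intro conjI subsetI)
    fix u assume "u \<in> bx (n - (K + m))"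
    then have "u + p \<in> bx (n - K)" using n m unfolding mem_bx fst_add snd_add by linarith
    then have "u + p \<in> B n" using K[of n] n by auto
    then show "u \<in> (\<lambda>u. u - p) ` B n" by (force intro: image_eqI[of _ _ "u + p"])
  next
    fix u assume "u \<in> (\<lambda>u. u - p) ` B n"
    then obtain w where "w \<in> bx (n + K)" "u = w - p" using K[of n] n by auto
    then show "u \<in> bx (n + (K + m))" using m by (simp add: mem_bx) linarith
  qed
  then show ?thesis unfolding near_boxes_def by blast
qed

text \<open>After translation by \<open>p\<close> the domains are still close to boxes, so by monotonicity the value at the
  diagonal lies between \<open>gdiag (n - K)\<close> and \<open>gdiag (n + K)\<close>.\<close>

lemma green_diag_gap:
  assumes "near_boxes B"
  shows "(\<lambda>n. green plain_cond (B n) p p - gdiag n) \<longlonglongrightarrow> 0"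
proof -
  obtain K where K: "\<And>n. n \<ge> K \<Longrightarrow> bx (n - K) \<subseteq> (\<lambda>u. u - p) ` B n \<and> (\<lambda>u. u - p) ` B n \<subseteq> bx (n + K)"
    using near_boxes_translate[OF assms, of p] unfolding near_boxes_def by blast
  obtain m where m: "\<And>n. n \<ge> m \<Longrightarrow> finite (B n) \<and> p \<in> B n"
    using eventually_near_boxes[OF assms] by metis
  have *: "norm (green plain_cond (B n) p p - gdiag n) \<le> gdiag (n - K + 2 * K) - gdiag (n - K)"
    if n: "n \<ge> m + K" for n
  proof -
    let ?B = "(\<lambda>u. u - p) ` B n"
    have fin: "finite ?B" and 0: "0 \<in> ?B" using m n by (auto simp: image_iff)
    have "gdiag (n - K) \<le> green plain_cond ?B 0 0"
      using free.quad_mono[OF fin, of "bx (n - K)" 0 0 1 0] K[of n] n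
      by (simp add: zero_bx free.quad_def gdiag_def)
    moreover have "green plain_cond ?B 0 0 \<le> gdiag (n + K)"
      using free.quad_mono[OF finite_bx, of ?B "n + K" 0 0 1 0] K[of n] n 0
      by (simp add: free.quad_def gdiag_def)
    moreover have "green plain_cond ?B 0 0 = green plain_cond (B n) p p"
      using m n by (intro green_translate) auto
    moreover have "gdiag (n - K) \<le> gdiag n" "gdiag n \<le> gdiag (n + K)" by (auto intro: gdiag_mono)
    moreover have eq: "n - K + 2 * K = n + K" using n by simp
    ultimately show ?thesis unfolding eq real_norm_def by linarith
  qed
  have "(\<lambda>n. gdiag (n - K + 2 * K) - gdiag (n - K)) \<longlonglongrightarrow> 0"
    by (rule filterlim_compose[OF gdiag_gap filterlim_minus_const_nat_at_top])
  then show ?thesis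
    by (rule Lim_null_comparison[rotated]) (use * eventually_at_top_linorder in blast)
qed

text \<open>Polarization with the neutral charge \<open>\<delta>\<^sub>p - \<delta>\<^sub>q\<close>, on which the form is bounded because the energy
  controls differences. The two diagonal terms have the same divergence \<open>gdiag n\<close>.\<close>

lemma free_potential_converges:
  "\<exists>l. \<forall>B. near_boxes B \<longrightarrow> (\<lambda>n. green plain_cond (B n) p q - green plain_cond (B n) p p) \<longlonglongrightarrow> l"
proof -
  define C where "C = real_of_int (\<bar>fst p - fst q\<bar> + \<bar>snd p - snd q\<bar>)"
  have "\<bar>1 * f p + (-1) * f q\<bar> \<le> C * sqrt (energy plain_cond B f)" if "finite B" "vanish_off B f" for B f
  proof -
    have "\<bar>f p - f q\<bar> \<le> C * sqrt (energy plain_cond B f)"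
      unfolding C_def by (rule lipschitz_site)
        (use free.edge_le_energy[OF that] in \<open>simp_all add: plain_cond_def abs_minus_commute\<close>)
    then show ?thesis by simp
  qed
  then obtain l where l: "\<And>B. near_boxes B \<Longrightarrow> (\<lambda>n. free.quad (B n) 1 (-1) p q) \<longlonglongrightarrow> l"
    using free.quad_converges[of 1 p "-1" q C] by blast
  have "(\<lambda>n. green plain_cond (B n) p q - green plain_cond (B n) p p) \<longlonglongrightarrow> - l / 2" if B: "near_boxes B" for B
  proof -
    have "(\<lambda>n. ((green plain_cond (B n) q q - gdiag n) - (green plain_cond (B n) p p - gdiag n)
        - free.quad (B n) 1 (-1) p q) / 2) \<longlonglongrightarrow> ((0 - 0) - l) / 2"
      using B l by (intro tendsto_intros green_diag_gap) auto
    then show ?thesis by (simp add: free.quad_def diff_divide_distrib)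
  qed
  then show ?thesis by blast
qed

section \<open>The Laplacian on the double covers\<close>

definition emb :: "real \<Rightarrow> site \<Rightarrow> point" where
  "emb d p = (of_int (fst p) + d, of_int (snd p) + d)"

definition site_of :: "real \<Rightarrow> point \<Rightarrow> site" where
  "site_of d z = (\<lfloor>fst z - d\<rfloor>, \<lfloor>snd z - d\<rfloor>)"

lemma site_of_emb [simp]: "site_of d (emb d p) = p"
  by (simp add: site_of_def emb_def)

lemma emb_inject [simp]: "emb d p = emb d q \<longleftrightarrow> p = q"
  by (auto simp: emb_def prod_eq_iff)

locale lattice_model =
  fixes d :: real and L :: "point set"
  assumes model: "d = 0 \<and> L = Z2 \<or> d = 1/2 \<and> L = H2"
begin

lemma emb_mem: "emb d p \<in> L"
  using model by (elim disjE conjE; hypsubst) (auto simp: emb_def Z2_def H2_def)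

lemma mem_emb: "z \<in> L \<Longrightarrow> z = emb d (site_of d z)"
  using model
  by (cases z; elim disjE conjE; hypsubst) (auto simp: emb_def site_of_def Z2_def H2_def elim!: Ints_cases)

lemma nn_emb: "{z \<in> L. nn (emb d p) z} = emb d ` nbrs p"
  using nn_nbrs[of L "of_int (fst p) + d" "of_int (snd p) + d"] model emb_mem[of p]
  by (auto simp: emb_def nbrs_def algebra_simps)

lemma emb_eq_0: "emb d p = 0 \<longleftrightarrow> d = 0 \<and> p = 0"
proof -
  have "of_int i + 1/2 \<noteq> (0::real)" for i
  proof
    assume "of_int i + 1/2 = (0::real)"
    then have "of_int (2 * i + 1) = (of_int 0 :: real)" by simp
    then have "2 * i + 1 = 0" by (simp only: of_int_eq_iff)
    then show False by presburger
  qed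
  then show ?thesis
    using model by (elim disjE conjE; hypsubst) (auto simp: emb_def prod_eq_iff)
qed

lemma branch_cut_emb: "branch_cut (emb d p) (emb d q) \<longleftrightarrow> site_cut p q"
proof -
  have *: "2 * (real_of_int i + d) \<le> -1 \<longleftrightarrow> i \<le> -1" for i
    using model by auto
  have **: "real_of_int i + d = real_of_int j + d + 1 \<longleftrightarrow> i = j + 1"
    "real_of_int i + d = real_of_int j + d - 1 \<longleftrightarrow> i = j - 1" for i j
    by linarith+
  show ?thesis
    unfolding emb_def branch_cut_iff * ** site_cut_def half_cut_def
    by (cases p; cases q) auto
qed

definition lattice_box :: "nat \<Rightarrow> site set" where
  "lattice_box n = {p. emb d p \<in> sq_box n}"

lemma lattice_box_bounds: "bx (n - 1) \<subseteq> lattice_box n" "lattice_box n \<subseteq> bx n" if "n \<ge> 1"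
  using model that by (auto simp: lattice_box_def emb_def sq_box_def mem_bx)

lemma near_boxes_lattice_box: "near_boxes lattice_box"
  unfolding near_boxes_def
proof (intro exI[of _ 1] allI impI)
  fix n :: nat assume "1 \<le> n"
  then show "bx (n - 1) \<subseteq> lattice_box n \<and> lattice_box n \<subseteq> bx (n + 1)"
    using lattice_box_bounds[of n] bx_mono[of n "n + 1"] by auto
qed

lemma finite_lattice_box: "finite (lattice_box n)"
proof -
  have "lattice_box n \<subseteq> bx n"
    using model by (auto simp: lattice_box_def emb_def sq_box_def mem_bx)
  then show ?thesis using finite_subset finite_bx by blast
qed

text \<open>Both values of \<open>s\<close> give the same vertex over a branch point, in agreement with its representative
  \<open>(0, True)\<close>.\<close>

definition vert :: "site \<Rightarrow> bool \<Rightarrow> cpoint" where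
  "vert p s = (emb d p, s \<or> emb d p = 0)"

lemma vert_mem: "vert p s \<in> cover L"
  using emb_mem by (auto simp: vert_def cover_def)

lemma mem_cover: "v \<in> cover L \<Longrightarrow> v = vert (site_of d (fst v)) (snd v)"
  using mem_emb by (cases v) (auto simp: cover_def vert_def)

lemma vert_eq_iff: "vert p s = vert q t \<longleftrightarrow> p = q \<and> (s = t \<or> emb d p = 0)"
  by (auto simp: vert_def)

lemma vert_mem_box: "vert p s \<in> cover_box L n \<longleftrightarrow> p \<in> lattice_box n"
  using vert_mem[of p s] by (simp add: cover_box_def lattice_box_def cover_proj_def vert_def)

lemma mem_cover_box: "v \<in> cover_box L n \<Longrightarrow> \<exists>p s. v = vert p s \<and> p \<in> lattice_box n"
proof -
  assume v: "v \<in> cover_box L n"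
  then have "v \<in> cover L" by (simp add: cover_box_def)
  then have eq: "v = vert (site_of d (fst v)) (snd v)" by (rule mem_cover)
  have "site_of d (fst v) \<in> lattice_box n"
    using v by (subst (asm) eq) (simp only: vert_mem_box)
  then show ?thesis using eq by blast
qed

lemma swap_vert: "sheet_swap (vert p s) = vert p (\<not> s)"
  by (simp add: sheet_swap_def vert_def)

lemma cover_laplacian_regular:
  assumes "emb d p \<noteq> 0"
  shows "cover_laplacian L f (vert p s)
    = (\<Sum>q\<in>nbrs p. f (vert p s) - f (vert q (s = (\<not> site_cut p q))))"
proof -
  have "cover_nbrs L (vert p s) = (\<lambda>q. vert q (s = (\<not> site_cut p q))) ` nbrs p" (is "?A = ?g ` _")
  proof (intro subset_antisym subsetI)
    fix v assume v: "v \<in> ?A"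
    then have "v \<in> cover L" by (simp add: cover_nbrs_def)
    then obtain q t where vq: "v = vert q t" using mem_cover by blast
    have adj: "cover_adj (vert p s) (vert q t)" using v vq by (simp add: cover_nbrs_def)
    then have "emb d q \<in> {z \<in> L. nn (emb d p) z}"
      using emb_mem by (simp add: cover_adj_def cover_proj_def vert_def)
    then have "q \<in> nbrs p" unfolding nn_emb by auto
    moreover have "v = ?g q"
      using adj assms unfolding vq vert_eq_iff
      by (auto simp: cover_adj_def cover_proj_def vert_def branch_cut_emb)
    ultimately show "v \<in> ?g ` nbrs p" by blast
  next
    fix v assume "v \<in> ?g ` nbrs p"
    then obtain q where q: "q \<in> nbrs p" "v = ?g q" by blast
    have "emb d q \<in> {z \<in> L. nn (emb d p) z}" unfolding nn_emb using q by blast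
    then show "v \<in> ?A"
      using q assms vert_mem by (auto simp: cover_nbrs_def cover_adj_def cover_proj_def vert_def branch_cut_emb)
  qed
  moreover have "inj_on ?g (nbrs p)" by (rule inj_onI) (simp add: vert_eq_iff)
  ultimately show ?thesis unfolding cover_laplacian_def by (simp add: sum.reindex)
qed

lemma cover_laplacian_branch:
  assumes "emb d p = 0"
  shows "cover_laplacian L f (vert p s)
    = (\<Sum>q\<in>nbrs p. (f (vert p s) - f (vert q True)) + (f (vert p s) - f (vert q False)))"
proof -
  have p: "vert p s = (0, True)" using assms by (simp add: vert_def)
  have nz: "emb d q \<noteq> 0" if "q \<in> nbrs p" for q
    using assms that unfolding emb_eq_0 by (auto simp: nbrs_iff)
  have N: "{z \<in> L. nn 0 z} = emb d ` nbrs p" using nn_emb[of p] assms by simp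
  have "cover_laplacian L f (vert p s) = (\<Sum>z\<in>emb d ` nbrs p. \<Sum>t\<in>UNIV. f (vert p s) - f (z, t))"
    unfolding cover_laplacian_def p cover_nbrs_branch N by (simp add: sum.cartesian_product)
  also have "\<dots> = (\<Sum>q\<in>nbrs p. \<Sum>t\<in>UNIV. f (vert p s) - f (emb d q, t))"
    by (simp add: sum.reindex inj_on_def)
  also have "\<dots> = (\<Sum>q\<in>nbrs p. (f (vert p s) - f (vert q True)) + (f (vert p s) - f (vert q False)))"
    using nz by (intro sum.cong) (auto simp: UNIV_bool vert_def)
  finally show ?thesis .
qed

text \<open>At a branch vertex \<open>sym_part\<close> is twice the value of \<open>f\<close>, which is compensated by the eight
  neighbours there, and \<open>anti_part\<close> is \<open>0\<close>.\<close>

definition sym_part :: "(cpoint \<Rightarrow> real) \<Rightarrow> site \<Rightarrow> real" where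
  "sym_part f p = f (vert p True) + f (vert p False)"

definition anti_part :: "(cpoint \<Rightarrow> real) \<Rightarrow> site \<Rightarrow> real" where
  "anti_part f p = f (vert p True) - f (vert p False)"

lemma lap_sym_part:
  "emb d p \<noteq> 0 \<Longrightarrow> lap plain_cond (sym_part f) p
     = cover_laplacian L f (vert p True) + cover_laplacian L f (vert p False)"
  "emb d p = 0 \<Longrightarrow> lap plain_cond (sym_part f) p = cover_laplacian L f (vert p s)"
proof -
  assume nz: "emb d p \<noteq> 0"
  have "sym_part f p - sym_part f q = (f (vert p True) - f (vert q (True = (\<not> site_cut p q))))
      + (f (vert p False) - f (vert q (False = (\<not> site_cut p q))))" for q
    by (cases "site_cut p q") (simp_all add: sym_part_def)
  then show "lap plain_cond (sym_part f) p
     = cover_laplacian L f (vert p True) + cover_laplacian L f (vert p False)"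
    unfolding cover_laplacian_regular[OF nz] lap_plain sum.distrib[symmetric] by simp
next
  assume z: "emb d p = 0"
  have "vert p True = vert p s" "vert p False = vert p s" by (simp_all add: vert_eq_iff z)
  then have "sym_part f p = 2 * f (vert p s)" by (simp add: sym_part_def)
  then show "lap plain_cond (sym_part f) p = cover_laplacian L f (vert p s)"
    unfolding cover_laplacian_branch[OF z] lap_plain by (intro sum.cong) (auto simp: sym_part_def)
qed

lemma lap_anti_part:
  assumes "emb d p \<noteq> 0"
  shows "lap cut_cond (anti_part f) p
     = cover_laplacian L f (vert p True) - cover_laplacian L f (vert p False)"
  unfolding cover_laplacian_regular[OF assms] lap_def sum_subtractf[symmetric]
  by (intro sum.cong) (auto simp: anti_part_def cut_cond_def)

definition punctured_box :: "nat \<Rightarrow> site set" where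
  "punctured_box n = {p \<in> lattice_box n. emb d p \<noteq> 0}"

lemma finite_punctured_box: "finite (punctured_box n)"
  by (simp add: punctured_box_def finite_lattice_box)

definition same :: "bool \<Rightarrow> bool \<Rightarrow> real" where
  "same s t = (if s = t then 1 else -1)"

lemma cover_laplacian_injective:
  assumes f: "vanish_off (cover_box L n) f" and 0: "\<And>u. u \<in> cover_box L n \<Longrightarrow> cover_laplacian L f u = 0"
  shows "f v = 0"
proof -
  have z: "f (vert p s) = 0" if "p \<notin> lattice_box n" for p s
    using vanish_offD[OF f] that by (simp add: vert_mem_box)
  have l: "cover_laplacian L f (vert p s) = 0" if "p \<in> lattice_box n" for p s
    using 0 that by (simp add: vert_mem_box)
  have s: "sym_part f p = 0" for p
  proof (rule free.lap_injective[OF finite_lattice_box])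
    show "vanish_off (lattice_box n) (sym_part f)"
      using z by (simp add: vanish_off_def sym_part_def)
    show "lap plain_cond (sym_part f) u = 0" if "u \<in> lattice_box n" for u
      using lap_sym_part[of u] l[OF that] by (cases "emb d u = 0") auto
  qed
  have a: "anti_part f p = 0" for p
  proof (rule zip.lap_injective[OF finite_punctured_box])
    show "vanish_off (punctured_box n) (anti_part f)"
      unfolding vanish_off_def
    proof (intro allI impI)
      fix u assume "u \<notin> punctured_box n"
      then have "u \<notin> lattice_box n \<or> vert u True = vert u False"
        by (auto simp: punctured_box_def vert_eq_iff)
      then show "anti_part f u = 0" using z[of u] by (auto simp: anti_part_def)
    qed
    show "lap cut_cond (anti_part f) u = 0" if "u \<in> punctured_box n" for u
      using lap_anti_part[of u] l[of u] that by (simp add: punctured_box_def)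
  qed
  have "f (vert p True) = 0 \<and> f (vert p False) = 0" for p
    using s[of p] a[of p] by (simp add: sym_part_def anti_part_def)
  then have "f (vert p s) = 0" for p s by (cases s) auto
  then show ?thesis using mem_cover_box[of v n] vanish_offD[OF f, of v] by blast
qed

text \<open>For fixed second argument the symmetric and the antisymmetric part of the right-hand side are, up to
  the sign \<open>same True t\<close>, the two Green's functions on the base, so its Laplacian is read off from \<open>lap_sym_part\<close> and
  \<open>lap_anti_part\<close>. Over a branch vertex the sign \<open>same s t\<close> depends on the choice of \<open>s\<close>, but it
  multiplies \<open>0\<close> there.\<close>

lemma cover_green_n_vert:
  "cover_green_n L n (vert p s) (vert q t)
    = (green plain_cond (lattice_box n) p q + same s t * green cut_cond (punctured_box n) p q) / 2"
proof -
  let ?S = "green plain_cond (lattice_box n)" and ?A = "green cut_cond (punctured_box n)"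
  note S = free.green_char[OF finite_lattice_box[of n]]
  note A = zip.green_char[OF finite_punctured_box[of n]]
  define g where "g = (\<lambda>v w. if v \<in> cover_box L n \<and> w \<in> cover_box L n
    then (?S (site_of d (fst v)) (site_of d (fst w))
      + same (snd v) (snd w) * ?A (site_of d (fst v)) (site_of d (fst w))) / 2 else 0)"
  have g: "g (vert p s) (vert q t) = (?S p q + same s t * ?A p q) / 2" for p q s t
  proof (cases "p \<in> lattice_box n \<and> q \<in> lattice_box n")
    case True
    have "?A p q = 0 \<or> emb d p \<noteq> 0 \<and> emb d q \<noteq> 0"
      using A(1)[of p q] by (auto simp: punctured_box_def)
    then have "same (snd (vert p s)) (snd (vert q t)) * ?A p q = same s t * ?A p q"
      by (auto simp: vert_def)
    then show ?thesis using True by (simp add: g_def vert_mem_box) (simp add: vert_def)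
  next
    case False
    then have "?S p q = 0" "?A p q = 0" using S(1)[of p q] A(1)[of p q] by (auto simp: punctured_box_def)
    then show ?thesis using False by (auto simp: g_def vert_mem_box)
  qed
  have inv: "cover_laplacian L (\<lambda>u. g u (vert q t)) (vert p s) = (if vert p s = vert q t then 1 else 0)"
    if pq: "p \<in> lattice_box n" "q \<in> lattice_box n" for p q s t
  proof -
    let ?f = "\<lambda>u. g u (vert q t)"
    have sym: "sym_part ?f = (\<lambda>u. ?S u q)"
      unfolding sym_part_def g same_def by (cases t) (simp_all add: field_simps)
    \<comment> \<open>The summand with factor \<open>0\<close> brings the function into the form of \<open>lap_lincomb\<close>.\<close>
    have anti: "anti_part ?f = (\<lambda>u. same True t * ?A u q + 0 * ?A u q)"
      unfolding anti_part_def g same_def by (cases t) (simp_all add: field_simps)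
    have lsym: "lap plain_cond (sym_part ?f) p = (if p = q then 1 else 0)"
      unfolding sym using S(2) pq by simp
    show ?thesis
    proof (cases "emb d p = 0")
      case True
      then show ?thesis using lap_sym_part(2)[OF True, of ?f s] lsym by (auto simp: vert_eq_iff)
    next
      case False
      have lanti: "lap cut_cond (anti_part ?f) p = same True t * (if p = q then 1 else 0)"
      proof (cases "q \<in> punctured_box n")
        case True
        then show ?thesis unfolding anti lap_lincomb using A(2) pq False by (simp add: punctured_box_def)
      next
        case q: False
        then have "p \<noteq> q" using pq False by (auto simp: punctured_box_def)
        then show ?thesis unfolding anti using A(1) q by (simp add: lap_def)
      qed
      show ?thesis
        using lap_sym_part(1)[OF False, of ?f] lap_anti_part[OF False, of ?f] False
        unfolding lsym lanti vert_eq_iff same_def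
        by (cases s; cases t; cases "p = q") simp_all
    qed
  qed
  have "cover_green_n L n = g"
    unfolding cover_green_n_def
  proof (rule dirichlet_green_eqI)
    show "cover_laplacian L (\<lambda>u. g u w) v = (if v = w then 1 else 0)"
      if v: "v \<in> cover_box L n" and w: "w \<in> cover_box L n" for v w
    proof -
      obtain p s q t where "v = vert p s" "p \<in> lattice_box n" "w = vert q t" "q \<in> lattice_box n"
        using mem_cover_box[OF v] mem_cover_box[OF w] by blast
      then show ?thesis using inv[of p q t s] by simp
    qed
    show "cover_laplacian L (\<lambda>u. f u - h u) v = cover_laplacian L f v - cover_laplacian L h v" for f h v
      unfolding cover_laplacian_def sum_subtractf[symmetric] by (simp add: algebra_simps)
    show "f v = 0" if "vanish_off (cover_box L n) f" "\<And>u. u \<in> cover_box L n \<Longrightarrow> cover_laplacian L f u = 0" for f v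
      by (rule cover_laplacian_injective[OF that])
    show "g v w = 0" if "v \<notin> cover_box L n \<or> w \<notin> cover_box L n" for v w
      unfolding g_def using that by (simp only: if_False de_Morgan_conj[symmetric])
  qed
  then show ?thesis by (simp add: g)
qed

lemma cover_green_anti_vert:
  assumes a: "\<And>q. (\<lambda>n. green cut_cond (punctured_box n) p q) \<longlonglongrightarrow> a q"
  shows "cover_green_anti L (vert p s) (vert q t) = same s t * a q"
proof -
  obtain l where l: "(\<lambda>n. green plain_cond (lattice_box n) p q - green plain_cond (lattice_box n) p p) \<longlonglongrightarrow> l"
    using free_potential_converges near_boxes_lattice_box by blast
  have lim: "cover_green L (vert p s) (vert q t) = (l + (same s t * a q - a p)) / 2" for s
  proof -
    have "(\<lambda>n. ((green plain_cond (lattice_box n) p q - green plain_cond (lattice_box n) p p)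
        + (same s t * green cut_cond (punctured_box n) p q - green cut_cond (punctured_box n) p p)) / 2)
        \<longlonglongrightarrow> (l + (same s t * a q - a p)) / 2"
      by (intro tendsto_intros l a) simp
    moreover have "cover_green_n L n (vert p s) (vert q t) - cover_green_n L n (vert p s) (vert p s)
      = ((green plain_cond (lattice_box n) p q - green plain_cond (lattice_box n) p p)
        + (same s t * green cut_cond (punctured_box n) p q - green cut_cond (punctured_box n) p p)) / 2" for n
      unfolding cover_green_n_vert by (simp add: same_def field_simps)
    ultimately have "(\<lambda>n. cover_green_n L n (vert p s) (vert q t) - cover_green_n L n (vert p s) (vert p s))
        \<longlonglongrightarrow> (l + (same s t * a q - a p)) / 2"
      by (simp only:)
    then show ?thesis unfolding cover_green_def by (rule limI)
  qed
  show ?thesis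
    unfolding cover_green_anti_def swap_vert lim by (auto simp: same_def field_simps)
qed

end

section \<open>The antisymmetric Green's functions\<close>

interpretation vertex: lattice_model 0 Z2 by unfold_locales simp
interpretation face: lattice_model "1/2" H2 by unfold_locales simp

lemma lattice_box_vertex: "vertex.lattice_box n = bx n"
  by (auto simp: vertex.lattice_box_def emb_def sq_box_def mem_bx abs_le_iff)

lemma G_Z_n_emb: "G_Z_n n (emb 0 p) (emb 0 q) = green cut_cond (bx n) p q"
proof -
  let ?B = "Z2 \<inter> sq_box n"
  have mem: "emb 0 p \<in> ?B \<longleftrightarrow> p \<in> bx n" for p
    using vertex.emb_mem lattice_box_vertex by (auto simp: vertex.lattice_box_def)
  have ex: "\<exists>p\<in>bx n. z = emb 0 p" if "z \<in> ?B" for z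
  proof -
    have eq: "z = emb 0 (site_of 0 z)" using that by (intro vertex.mem_emb) simp
    then have "site_of 0 z \<in> bx n" using that mem by metis
    then show ?thesis using eq by blast
  qed
  have lap: "zipper_laplacian f (emb 0 p) = lap cut_cond (\<lambda>u. f (emb 0 u)) p" for f p
    unfolding zipper_laplacian_def vertex.nn_emb lap_def
    by (simp add: sum.reindex inj_on_def zipper_cond_def cut_cond_def zipper_iff_cut
        vertex.emb_mem vertex.branch_cut_emb)
  define g where "g = (\<lambda>z w. if z \<in> ?B \<and> w \<in> ?B then green cut_cond (bx n) (site_of 0 z) (site_of 0 w) else 0)"
  have g: "g (emb 0 p) (emb 0 q) = green cut_cond (bx n) p q" for p q
    unfolding g_def mem by (simp add: zip.green_char(1))
  have "G_Z_n n = g"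
    unfolding G_Z_n_def
  proof (rule dirichlet_green_eqI)
    show "zipper_laplacian (\<lambda>u. g u w) v = (if v = w then 1 else 0)" if "v \<in> ?B" "w \<in> ?B" for v w
      using ex[OF that(1)] ex[OF that(2)] by (auto simp: lap g zip.green_char(2))
    show "zipper_laplacian (\<lambda>u. f u - h u) v = zipper_laplacian f v - zipper_laplacian h v" for f h v
      unfolding zipper_laplacian_def sum_subtractf[symmetric] by (simp add: algebra_simps)
    show "f v = 0" if f: "vanish_off ?B f" "\<And>u. u \<in> ?B \<Longrightarrow> zipper_laplacian f u = 0" for f v
    proof (cases "v \<in> ?B")
      case True
      then obtain p where p: "v = emb 0 p" using ex by blast
      show ?thesis
        unfolding p
      proof (rule zip.lap_injective[OF finite_bx, of n "\<lambda>u. f (emb 0 u)"])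
        show "vanish_off (bx n) (\<lambda>u. f (emb 0 u))"
          using f(1) mem by (auto simp: vanish_off_def)
        show "lap cut_cond (\<lambda>u. f (emb 0 u)) u = 0" if "u \<in> bx n" for u
          using f(2)[of "emb 0 u"] mem that by (simp add: lap)
      qed
    qed (use f(1) in \<open>simp add: vanish_off_def\<close>)
  qed (auto simp: g_def)
  then show ?thesis by (simp add: g)
qed

lemma green_tendsto_G_Z:
  assumes "near_boxes B"
  shows "(\<lambda>n. green cut_cond (B n) p q) \<longlonglongrightarrow> G_Z (emb 0 p) (emb 0 q)"
proof -
  obtain l where l: "\<And>B. near_boxes B \<Longrightarrow> (\<lambda>n. green cut_cond (B n) p q) \<longlonglongrightarrow> l"
    using zip_green_converges by blast
  have "G_Z (emb 0 p) (emb 0 q) = l"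
    unfolding G_Z_def G_Z_n_emb using l[OF near_boxes_bx] by (rule limI)
  then show ?thesis using l[OF assms] by simp
qed

text \<open>The limit of the increasing positive sequence \<open>green cut_cond (bx n) 0 0\<close>; positivity makes the
  quotient in the formula for \<open>\<Sigma>\<close> pass to the limit.\<close>

lemma G_Z_origin_pos: "0 < G_Z 0 0"
proof -
  have 0: "emb 0 0 = 0" by (simp add: emb_def zero_prod_def)
  have "green cut_cond (bx 0) 0 0 \<le> green cut_cond (bx n) 0 0" for n
    using zip.quad_mono[OF finite_bx bx_mono[of 0 n], of 0 0 1 0] by (simp add: zip.quad_def zero_bx)
  then have "green cut_cond (bx 0) 0 0 \<le> G_Z 0 0"
    using green_tendsto_G_Z[OF near_boxes_bx, of 0 0] unfolding 0
    by (intro LIMSEQ_le_const) auto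
  moreover have "0 < green cut_cond (bx 0) 0 0"
    by (rule zip.green_diag_pos) (simp_all add: zero_bx)
  ultimately show ?thesis by linarith
qed

theorem mainTheorem4:
  shows "(\<forall>v\<in>Xi_cover. \<forall>w\<in>Xi_cover.
            GA_Xi v w = eps v w * G_Z (cover_proj v - (1/2, 1/2)) (cover_proj w - (1/2, 1/2))) \<and>
         (\<forall>v\<in>Sigma_cover. \<forall>w\<in>Sigma_cover.
            GA_Sigma v w =
              eps v w * (G_Z (cover_proj v) (cover_proj w) - G_Z (cover_proj v) 0 * G_Z 0 (cover_proj w) / G_Z 0 0))"
proof (intro conjI ballI)
  fix v w assume vw: "v \<in> Xi_cover" "w \<in> Xi_cover"
  define p q where "p = site_of (1/2) (fst v)" and "q = site_of (1/2) (fst w)"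
  have v: "v = face.vert p (snd v)" and w: "w = face.vert q (snd w)"
    unfolding p_def q_def by (rule face.mem_cover[OF vw(1)], rule face.mem_cover[OF vw(2)])
  have pv: "cover_proj v - (1/2, 1/2) = emb 0 p" "cover_proj w - (1/2, 1/2) = emb 0 q"
    by (subst v w, simp add: cover_proj_def face.vert_def emb_def)+
  have "face.punctured_box = face.lattice_box"
    by (auto simp: face.punctured_box_def face.emb_eq_0 fun_eq_iff)
  then have "(\<lambda>n. green cut_cond (face.punctured_box n) p q) \<longlonglongrightarrow> G_Z (emb 0 p) (emb 0 q)" for q
    using green_tendsto_G_Z[OF face.near_boxes_lattice_box] by simp
  from face.cover_green_anti_vert[OF this, of "snd v" q "snd w"]
  show "GA_Xi v w = eps v w * G_Z (cover_proj v - (1/2, 1/2)) (cover_proj w - (1/2, 1/2))"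
    unfolding pv v[symmetric] w[symmetric] by (simp add: face.same_def eps_def)
next
  fix v w assume vw: "v \<in> Sigma_cover" "w \<in> Sigma_cover"
  define p q where "p = site_of 0 (fst v)" and "q = site_of 0 (fst w)"
  have v: "v = vertex.vert p (snd v)" and w: "w = vertex.vert q (snd w)"
    unfolding p_def q_def by (rule vertex.mem_cover[OF vw(1)], rule vertex.mem_cover[OF vw(2)])
  have pv: "cover_proj v = emb 0 p" "cover_proj w = emb 0 q"
    by (subst v w, simp add: cover_proj_def vertex.vert_def)+
  have 0: "emb 0 0 = 0" by (simp add: emb_def zero_prod_def)
  have "vertex.punctured_box n = bx n - {0}" for n
    by (auto simp: vertex.punctured_box_def lattice_box_vertex vertex.emb_eq_0)
  moreover have "(\<lambda>n. green cut_cond (bx n - {0}) p q) \<longlonglongrightarrow>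
      G_Z (emb 0 p) (emb 0 q) - G_Z (emb 0 p) 0 * G_Z 0 (emb 0 q) / G_Z 0 0" for q
    unfolding zip.green_remove_point[OF finite_bx zero_bx]
    using green_tendsto_G_Z[OF near_boxes_bx, of p 0] green_tendsto_G_Z[OF near_boxes_bx, of 0 q]
      green_tendsto_G_Z[OF near_boxes_bx, of 0 0] G_Z_origin_pos unfolding 0
    by (intro tendsto_intros green_tendsto_G_Z[OF near_boxes_bx]) auto
  ultimately have "(\<lambda>n. green cut_cond (vertex.punctured_box n) p q) \<longlonglongrightarrow>
      G_Z (emb 0 p) (emb 0 q) - G_Z (emb 0 p) 0 * G_Z 0 (emb 0 q) / G_Z 0 0" for q by simp
  from vertex.cover_green_anti_vert[OF this, of "snd v" q "snd w"]
  show "GA_Sigma v w =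
      eps v w * (G_Z (cover_proj v) (cover_proj w) - G_Z (cover_proj v) 0 * G_Z 0 (cover_proj w) / G_Z 0 0)"
    unfolding pv v[symmetric] w[symmetric] by (simp add: vertex.same_def eps_def)
qed

end
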